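(* Let $\ell\ge 0$ and assume that $H_0=\max_{T\in\mathcal T_0}h_T$ is small enough so that $$\max_{j\in J}\|u_j-\Lambda_\ell u_j\|_\Omega\le \sqrt{1+(2N)^{-1}}-1 .$$ Then for every $T\in\mathcal T_\ell$, $$\mu_\ell(T)^2\le \tfrac32\,\eta_\ell(T)^2\le 3\,\mu_\ell(T)^2 .$$
   Context: Setting. $\Omega\subset\mathbb R^d$, $d\in\{2,3\}$, is a polyhedral domain; $(u,v)=\int_\Omega uv\,dx$, $a(u,v)=\int_\Omega\nabla u\cdot\nabla v\,dx$, and $\|\cdot\|_D$ is the $L_2$ norm over $D$. Let $0<\lambda_1<\lambda_2\le\lambda_3\le\dots$ be the eigenvalues, with corresponding $L_2(\Omega)$-orthonormal eigenfunctions $u_1,u_2,\dots\in H_0^1(\Omega)$, of the problem $a(u_j,v)=\lambda_j(u_j,v)$ for all $v\in H_0^1(\Omega)$. Meshes and spaces. $\mathcal T_0$ is a conforming simplicial mesh of $\Omega$, and $\{\mathcal T_\ell\}_{\ell\ge0}$ is a sequence of conforming simplicial meshes, each $\mathcal T_{\ell+1}$ being a refinement of $\mathcal T_\ell$ obtained by newest-vertex bisection (or its generalization to higher dimension). $h_T=\mathrm{diam}(T)$. $\mathbb V_\ell\subset H_0^1(\Omega)$ is the space of continuous piecewise polynomials of arbitrary but fixed degree $r\ge1$ on $\mathcal T_\ell$ (vanishing on $\partial\Omega$). Let $\lambda_{\ell,1}\le\lambda_{\ell,2}\le\dots\le\lambda_{\ell,\dim\mathbb V_\ell}$ be the discrete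 eigenvalues, with $L_2(\Omega)$-orthonormal discrete eigenfunctions $u_{\ell,j}\in\mathbb V_\ell$: $a(u_{\ell,j},v)=\lambda_{\ell,j}(u_{\ell,j},v)$ for all $v\in\mathbb V_\ell$. Cluster. $J=\{n+1,\dots,n+N\}$ for some $n\ge0$, $N\ge1$ (with $n+N\le\dim\mathbb V_0$). Standing assumptions: $\lambda_n<\lambda_{n+1}\le\dots\le\lambda_{n+N}<\lambda_{n+N+1}$ (with $\lambda_0=0$), and the discrete cluster respects this separation: $\lambda_{\ell,n}<\lambda_{n+1}$ and $\lambda_{\ell,n+N}<\lambda_{n+N+1}$. $\mathbb W_\ell=\mathrm{span}\{u_{\ell,j}\}_{j\in J}$. Projections. $P_\ell:L_2(\Omega)\to\mathbb W_\ell$ is the $L_2$-orthogonal projection, $(P_\ell u,v)=(u,v)$ for all $v\in\mathbb W_\ell$. $G_\ell:H_0^1(\Omega)\to\mathbb V_\ell$ is the Ritz projection, $a(G_\ell u,v)=a(u,v)$ for all $v\in\mathbb V_\ell$. $\Lambda_\ell:=P_\ell\circ G_\ell$. Error indicators. For $T\in\mathcal T_\ell$, $$\eta_\ell(T)^2:=\sum_{j\in J}\Big(h_T^2\|\Delta u_{\ell,j}+\lambda_{\ell,j}u_{\ell,j}\|_T^2+h_T\|[\![\nabla u_{\ell,j}]\!]\|_{\partial T}^2\Big),$$ $$\mu_\ell(T)^2:=\sum_{j\in J}\Big(h_T^2\|\lambda_jP_\ell u_j+\Delta\Lambda_\ell u_j\|_T^2+h_T\|[\![\nabla\Lambda_\ell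 u_j]\!]\|_{\partial T}^2\Big),$$ where $\Delta$ is applied elementwise and $[\![\cdot]\!]$ denotes the jump across the element boundary (across interior faces; taken to be zero on faces contained in $\partial\Omega$). *)

theory Defs
  imports "HOL-Analysis.Analysis" "HOL-Library.Function_Algebras"
begin

section \<open>Lebesgue and Sobolev spaces\<close>

text \<open>
  Elements of L2 and of the Sobolev spaces are represented by functions on the whole space, of
  which only the almost-everywhere class on the domain matters.
\<close>

definition L2 :: "(real^'n) set \<Rightarrow> (real^'n \<Rightarrow> 'b::euclidean_space) set" where
  "L2 D = {f. f \<in> borel_measurable (lebesgue_on D)
            \<and> integrable (lebesgue_on D) (\<lambda>x. (norm (f x))^2)}"

definition L2_inner :: "(real^'n) set \<Rightarrow> (real^'n \<Rightarrow> real) \<Rightarrow> (real^'n \<Rightarrow> real) \<Rightarrow> real" where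
  "L2_inner D f g = (LINT x|lebesgue_on D. f x * g x)"

definition L2_norm :: "(real^'n) set \<Rightarrow> (real^'n \<Rightarrow> 'b::euclidean_space) \<Rightarrow> real" where
  "L2_norm D f = sqrt (LINT x|lebesgue_on D. (norm (f x))^2)"

definition gradient_within :: "(real^'n) set \<Rightarrow> (real^'n \<Rightarrow> real) \<Rightarrow> real^'n \<Rightarrow> real^'n" where
  "gradient_within S f x = (\<chi> i. frechet_derivative f (at x within S) (axis i 1))"

fun C_k :: "nat \<Rightarrow> (real^'n \<Rightarrow> real) \<Rightarrow> bool" where
  "C_k 0 f = continuous_on UNIV f"
| "C_k (Suc k) f = ((\<forall>x. f differentiable (at x)) \<and>
                    (\<forall>i. C_k k (\<lambda>x. gradient_within UNIV f x $ i)))"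

definition test_functions :: "(real^'n) set \<Rightarrow> (real^'n \<Rightarrow> real) set" where
  "test_functions D = {\<phi>. (\<forall>k. C_k k \<phi>) \<and> (\<exists>K. compact K \<and> K \<subseteq> D \<and> (\<forall>x. x \<notin> K \<longrightarrow> \<phi> x = 0))}"

definition has_weak_gradient ::
  "(real^'n) set \<Rightarrow> (real^'n \<Rightarrow> real) \<Rightarrow> (real^'n \<Rightarrow> real^'n) \<Rightarrow> bool" where
  "has_weak_gradient D u g \<longleftrightarrow>
     (\<forall>\<phi>\<in>test_functions D. \<forall>i.
        (LINT x|lebesgue_on D. u x * gradient_within UNIV \<phi> x $ i)
          = - (LINT x|lebesgue_on D. g x $ i * \<phi> x))"

definition H1 :: "(real^'n) set \<Rightarrow> (real^'n \<Rightarrow> real) set" where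
  "H1 D = {u \<in> L2 D. \<exists>g\<in>L2 D. has_weak_gradient D u g}"

text \<open>The weak gradient is unique up to a null set, so the choice below is immaterial.\<close>

definition weak_gradient :: "(real^'n) set \<Rightarrow> (real^'n \<Rightarrow> real) \<Rightarrow> real^'n \<Rightarrow> real^'n" where
  "weak_gradient D u = (SOME g. g \<in> L2 D \<and> has_weak_gradient D u g)"

text \<open>The closure of the test functions in the H1 norm.\<close>

definition H10 :: "(real^'n) set \<Rightarrow> (real^'n \<Rightarrow> real) set" where
  "H10 D = {u \<in> H1 D. \<exists>\<phi>. (\<forall>m::nat. \<phi> m \<in> test_functions D)
       \<and> (\<lambda>m. L2_norm D (\<lambda>x. u x - \<phi> m x)) \<longlonglongrightarrow> 0
       \<and> (\<lambda>m. L2_norm D (\<lambda>x. weak_gradient D u x - gradient_within UNIV (\<phi> m) x)) \<longlonglongrightarrow> 0}"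

definition dirichlet_form ::
  "(real^'n) set \<Rightarrow> (real^'n \<Rightarrow> real) \<Rightarrow> (real^'n \<Rightarrow> real) \<Rightarrow> real" where
  "dirichlet_form D u v = (LINT x|lebesgue_on D. weak_gradient D u x \<bullet> weak_gradient D v x)"

definition L2_orthonormal_on ::
  "(real^'n) set \<Rightarrow> nat set \<Rightarrow> (nat \<Rightarrow> real^'n \<Rightarrow> real) \<Rightarrow> bool" where
  "L2_orthonormal_on D I u \<longleftrightarrow>
     (\<forall>i\<in>I. \<forall>j\<in>I. L2_inner D (u i) (u j) = (if i = j then 1 else 0))"

text \<open>
  Eigenvalues are indexed from 1, with index 0 set to 0 by convention.  The last
  clause says that the sequence lists all eigenvalues, with multiplicity.
\<close>

definition dirichlet_eigensystem ::
  "(real^'n) set \<Rightarrow> (nat \<Rightarrow> real) \<Rightarrow> (nat \<Rightarrow> real^'n \<Rightarrow> real) \<Rightarrow> bool" where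
  "dirichlet_eigensystem D lam u \<longleftrightarrow>
     lam 0 = 0 \<and> 0 < lam 1 \<and> lam 1 < lam 2 \<and> (\<forall>j\<ge>2. lam j \<le> lam (Suc j))
   \<and> (\<forall>j\<ge>1. u j \<in> H10 D \<and> (\<forall>v\<in>H10 D. dirichlet_form D (u j) v = lam j * L2_inner D (u j) v))
   \<and> L2_orthonormal_on D {1..} u
   \<and> (\<forall>\<mu> w. w \<in> H10 D \<and> (\<forall>v\<in>H10 D. dirichlet_form D w v = \<mu> * L2_inner D w v) \<longrightarrow>
        (\<exists>c. AE x in lebesgue_on D. w x = (\<Sum>j | 1 \<le> j \<and> lam j = \<mu>. c j * u j x)))"

section \<open>Domains and meshes\<close>

definition polyhedral_domain :: "(real^'n) set \<Rightarrow> bool" where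
  "polyhedral_domain D \<longleftrightarrow>
     D \<noteq> {} \<and> open D \<and> connected D \<and> interior (closure D) = D
   \<and> (\<exists>\<P>. finite \<P> \<and> (\<forall>P\<in>\<P>. polytope P) \<and> closure D = \<Union>\<P>)"

text \<open>
  A tagged simplex consists of its vertices in order and a type between 0 and d - 1, as used
  by Maubach and Traxler for newest-vertex bisection in dimension d.
\<close>

type_synonym 'n tagged_simplex = "(real^'n) list \<times> nat"

definition wf_tagged_simplex :: "'n::finite tagged_simplex \<Rightarrow> bool" where
  "wf_tagged_simplex t \<longleftrightarrow>
     length (fst t) = CARD('n) + 1 \<and> distinct (fst t) \<and> \<not> affine_dependent (set (fst t))
   \<and> snd t < CARD('n)"

definition hull_of :: "'n::finite tagged_simplex \<Rightarrow> (real^'n) set" where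
  "hull_of t = convex hull (set (fst t))"

definition elements :: "'n::finite tagged_simplex set \<Rightarrow> (real^'n) set set" where
  "elements \<T> = hull_of ` \<T>"

text \<open>Conformity is part of the library notion of a triangulation.\<close>

definition conforming_mesh :: "(real^'n) set \<Rightarrow> 'n::finite tagged_simplex set \<Rightarrow> bool" where
  "conforming_mesh D \<T> \<longleftrightarrow>
     (\<forall>t\<in>\<T>. wf_tagged_simplex t) \<and> inj_on hull_of \<T>
   \<and> triangulation (elements \<T>) \<and> \<Union>(elements \<T>) = closure D"

text \<open>
  The bisection rule: the refinement edge of (z_0, ..., z_d) with type g is the segment from
  z_0 to z_d; with midpoint m, the children are (z_0, m, z_1, ..., z_g, z_{g+1}, ..., z_{d-1}) and
  (z_d, m, z_1, ..., z_g, z_{d-1}, ..., z_{g+1}), both of type g+1 modulo d.  For d = 2 the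
  refinement edge of both children is opposite to the new vertex m, which is the classical
  newest-vertex bisection.
\<close>

definition children :: "'n::finite tagged_simplex \<Rightarrow> 'n tagged_simplex set" where
  "children t =
    (let z = fst t; g = snd t; a = hd z; b = last z; m = midpoint a b;
         mid = butlast (tl z); g' = (g + 1) mod CARD('n)
     in {(a # m # take g mid @ drop g mid, g'), (b # m # take g mid @ rev (drop g mid), g')})"

definition bisection_step ::
  "'n::finite tagged_simplex set \<Rightarrow> 'n tagged_simplex set \<Rightarrow> bool" where
  "bisection_step \<T> \<T>' \<longleftrightarrow> (\<exists>t\<in>\<T>. \<T>' = (\<T> - {t}) \<union> children t)"

definition nvb_refinement ::
  "'n::finite tagged_simplex set \<Rightarrow> 'n tagged_simplex set \<Rightarrow> bool" where
  "nvb_refinement \<T> \<T>' \<longleftrightarrow> bisection_step\<^sup>*\<^sup>* \<T> \<T>'"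

section \<open>Finite element spaces\<close>

definition poly_deg_le :: "nat \<Rightarrow> (real^'n \<Rightarrow> real) \<Rightarrow> bool" where
  "poly_deg_le r p \<longleftrightarrow>
     (\<exists>c. \<forall>x. p x = (\<Sum>\<alpha> | sum \<alpha> UNIV \<le> r. c \<alpha> * (\<Prod>i\<in>UNIV. (x $ i) ^ \<alpha> i)))"

text \<open>
  Finite element functions are extended by 0 outside the (open) domain, so that they vanish on
  its boundary and are determined by their values on the domain.
\<close>

definition fe_space :: "(real^'n) set \<Rightarrow> (real^'n) set set \<Rightarrow> nat \<Rightarrow> (real^'n \<Rightarrow> real) set" where
  "fe_space D \<K> r = {v \<in> H10 D. continuous_on (closure D) v \<and> (\<forall>x. x \<notin> D \<longrightarrow> v x = 0)
     \<and> (\<forall>K\<in>\<K>. \<exists>p. poly_deg_le r p \<and> (\<forall>x\<in>K. v x = p x))}"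

definition fun_span :: "('a \<Rightarrow> real) set \<Rightarrow> ('a \<Rightarrow> real) set" where
  "fun_span = module.span (\<lambda>c f x. c * f x)"

definition fun_dim :: "('a \<Rightarrow> real) set \<Rightarrow> nat" where
  "fun_dim = vector_space.dim (\<lambda>(c::real) f x. c * f x)"

definition discrete_eigensystem ::
  "(real^'n) set \<Rightarrow> (real^'n \<Rightarrow> real) set \<Rightarrow> (nat \<Rightarrow> real) \<Rightarrow> (nat \<Rightarrow> real^'n \<Rightarrow> real) \<Rightarrow> bool" where
  "discrete_eigensystem D V lam u \<longleftrightarrow>
     lam 0 = 0 \<and> (\<forall>i\<in>{1..fun_dim V}. \<forall>j\<in>{1..fun_dim V}. i \<le> j \<longrightarrow> lam i \<le> lam j)
   \<and> (\<forall>j\<in>{1..fun_dim V}.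
        u j \<in> V \<and> (\<forall>v\<in>V. dirichlet_form D (u j) v = lam j * L2_inner D (u j) v))
   \<and> L2_orthonormal_on D {1..fun_dim V} u
   \<and> fun_span (u ` {1..fun_dim V}) = V"

definition is_L2_projection ::
  "(real^'n) set \<Rightarrow> (real^'n \<Rightarrow> real) set \<Rightarrow> ((real^'n \<Rightarrow> real) \<Rightarrow> real^'n \<Rightarrow> real) \<Rightarrow> bool" where
  "is_L2_projection D W P \<longleftrightarrow>
     (\<forall>f\<in>L2 D. P f \<in> W \<and> (\<forall>v\<in>W. L2_inner D (P f) v = L2_inner D f v))"

definition is_Ritz_projection ::
  "(real^'n) set \<Rightarrow> (real^'n \<Rightarrow> real) set \<Rightarrow> ((real^'n \<Rightarrow> real) \<Rightarrow> real^'n \<Rightarrow> real) \<Rightarrow> bool" where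
  "is_Ritz_projection D V G \<longleftrightarrow>
     (\<forall>w\<in>H10 D. G w \<in> V \<and> (\<forall>v\<in>V. dirichlet_form D (G w) v = dirichlet_form D w v))"

section \<open>Error indicators\<close>

text \<open>
  For a piecewise polynomial v and an element K, the derivatives within K are those of the
  polynomial v restricted to K, also at boundary points of K: the gradient within K is
  the one-sided trace there.
\<close>

definition laplacian_within :: "(real^'n) set \<Rightarrow> (real^'n \<Rightarrow> real) \<Rightarrow> real^'n \<Rightarrow> real" where
  "laplacian_within K v x =
     (\<Sum>i\<in>UNIV. frechet_derivative (gradient_within K v) (at x within K) (axis i 1) $ i)"

text \<open>
  Surface measure on a hyperplane H: the image of Lebesgue measure on the slab of thickness 1
  around H under the orthogonal projection onto H, hence (d-1)-dimensional Lebesgue measure by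
  Fubini's theorem.
\<close>

definition hyperplane_measure :: "(real^'n) set \<Rightarrow> (real^'n) measure" where
  "hyperplane_measure H =
     distr (restrict_space lborel {y. infdist y H \<le> 1/2}) borel (closest_point H)"

definition facet_integral :: "(real^'n) set \<Rightarrow> (real^'n \<Rightarrow> real) \<Rightarrow> real" where
  "facet_integral F f = (LINT x:F|hyperplane_measure (affine hull F). f x)"

definition is_neighbour ::
  "(real^'n) set set \<Rightarrow> (real^'n) set \<Rightarrow> (real^'n) set \<Rightarrow> (real^'n) set \<Rightarrow> bool" where
  "is_neighbour \<K> K F K' \<longleftrightarrow> K' \<in> \<K> \<and> K' \<noteq> K \<and> F facet_of K'"

text \<open>
  A facet F of K is interior if it is shared with another element, which is then unique; in a
  conforming mesh all other facets are contained in the boundary of the domain.  The jump is that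
  of the full gradient vector.
\<close>

definition gradient_jump ::
  "(real^'n) set set \<Rightarrow> (real^'n) set \<Rightarrow> (real^'n) set \<Rightarrow> (real^'n \<Rightarrow> real) \<Rightarrow> real^'n \<Rightarrow> real^'n" where
  "gradient_jump \<K> K F v x =
     (if \<exists>K'. is_neighbour \<K> K F K'
      then gradient_within K v x - gradient_within (SOME K'. is_neighbour \<K> K F K') v x
      else 0)"

definition jump_norm :: "(real^'n) set set \<Rightarrow> (real^'n) set \<Rightarrow> (real^'n \<Rightarrow> real) \<Rightarrow> real" where
  "jump_norm \<K> K v =
     sqrt (\<Sum>F | F facet_of K. facet_integral F (\<lambda>x. (norm (gradient_jump \<K> K F v x))^2))"

definition eta_indicator ::
  "nat set \<Rightarrow> (real^'n) set set \<Rightarrow> (nat \<Rightarrow> real) \<Rightarrow> (nat \<Rightarrow> real^'n \<Rightarrow> real) \<Rightarrow> (real^'n) set \<Rightarrow> real" where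
  "eta_indicator J \<K> lamh uh K = sqrt (\<Sum>j\<in>J.
       (diameter K)^2 * (L2_norm K (\<lambda>x. laplacian_within K (uh j) x + lamh j * uh j x))^2
     + diameter K * (jump_norm \<K> K (uh j))^2)"

definition mu_indicator ::
  "nat set \<Rightarrow> (real^'n) set set \<Rightarrow> (nat \<Rightarrow> real) \<Rightarrow> (nat \<Rightarrow> real^'n \<Rightarrow> real)
    \<Rightarrow> ((real^'n \<Rightarrow> real) \<Rightarrow> real^'n \<Rightarrow> real) \<Rightarrow> ((real^'n \<Rightarrow> real) \<Rightarrow> real^'n \<Rightarrow> real)
    \<Rightarrow> (real^'n) set \<Rightarrow> real" where
  "mu_indicator J \<K> lam u P \<Lambda> K = sqrt (\<Sum>j\<in>J.
       (diameter K)^2 * (L2_norm K (\<lambda>x. lam j * P (u j) x + laplacian_within K (\<Lambda> (u j)) x))^2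
     + diameter K * (jump_norm \<K> K (\<Lambda> (u j)))^2)"

end

theory Submission
  imports Defs
begin

text \<open>
  Both indicators are built from linear combinations of the same element residuals and
  gradient jumps. Write M for the square matrix of the coefficients of the \<Lambda> u_j in the basis
  of discrete eigenfunctions uh_i, i in J, of the cluster. The continuous and the discrete
  eigenvalue equations together give

    \<Lambda> u_j = sum_i M_ij uh_i   and   lambda_j P u_j = sum_i lambdah_i M_ij uh_i

  (lemma \<open>cluster_coefficient_relation\<close>). Therefore lambda_j P u_j + Laplace(\<Lambda> u_j) is the
  combination with coefficients M_ij of the residuals Laplace(uh_i) + lambdah_i uh_i, and the
  jumps of the gradients of \<Lambda> u_j are the same combination of those of the uh_i.

  It remains to see that M nearly preserves sums of squares. The entries of M^T M are the inner
  products of the \<Lambda> u_j, which deviate from those of the orthonormal u_j by at most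
  (1 + e)^2 - 1 = 1/(2N), where e = sqrt(1 + 1/(2N)) - 1 bounds the errors u_j - \<Lambda> u_j
  (lemma \<open>gram_of_perturbed_orthonormal\<close>). So the Frobenius norm of M^T M - I is at most 1/2.
  What the indicators call for is M M^T instead; but M is square, and M M^T - I has the same
  Frobenius norm (lemma \<open>gram_defect_transpose\<close>). Hence

    | sum_j |sum_i M_ij y_i|^2 - sum_i |y_i|^2 |  <=  1/2 sum_i |y_i|^2

  for all vectors y_i (lemma \<open>almost_orthogonal_sum_squares\<close>). Inserting the values of residuals
  and jumps at a point and integrating over the element and its facets yields
  |mu^2 - eta^2| <= eta^2/2 (lemma \<open>indicator_comparison\<close>), which is the assertion.

  The analytic content is that derivatives within an element are linear, also at boundary
  points, and that all integrals converge. The first rests on the uniqueness of derivatives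
  within convex sets with interior points (lemma \<open>has_derivative_within_convex_unique\<close>), the
  second on the continuity of polynomials and their derivatives up to the boundary and on the
  finiteness of the surface measure of a facet.
\<close>

section \<open>Nearly orthogonal square matrices\<close>
lemma gram_defect_expansion:
  fixes a :: "'i \<Rightarrow> 'i \<Rightarrow> real"
  assumes "finite J"
  shows "(\<Sum>i\<in>J. \<Sum>k\<in>J. ((\<Sum>j\<in>J. a i j * a k j) - (if i = k then 1 else 0))\<^sup>2)
       = (\<Sum>i\<in>J. \<Sum>k\<in>J. \<Sum>j\<in>J. \<Sum>l\<in>J. a i j * a k j * a i l * a k l)
         - 2 * (\<Sum>i\<in>J. \<Sum>j\<in>J. (a i j)\<^sup>2) + real (card J)"
proof -
  have "(\<Sum>i\<in>J. \<Sum>k\<in>J. ((\<Sum>j\<in>J. a i j * a k j) - (if i = k then 1 else 0))\<^sup>2)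
      = (\<Sum>i\<in>J. \<Sum>k\<in>J. (\<Sum>j\<in>J. a i j * a k j)\<^sup>2
           - (if i = k then 2 * (\<Sum>j\<in>J. a i j * a k j) else 0) + (if i = k then 1 else 0))"
    by (intro sum.cong refl) (auto simp: power2_eq_square algebra_simps)
  also have "\<dots> = (\<Sum>i\<in>J. \<Sum>k\<in>J. (\<Sum>j\<in>J. a i j * a k j)\<^sup>2)
      - (\<Sum>i\<in>J. 2 * (\<Sum>j\<in>J. a i j * a i j)) + real (card J)"
    using assms by (simp add: sum.distrib sum_subtractf)
  also have "(\<Sum>i\<in>J. \<Sum>k\<in>J. (\<Sum>j\<in>J. a i j * a k j)\<^sup>2)
      = (\<Sum>i\<in>J. \<Sum>k\<in>J. \<Sum>j\<in>J. \<Sum>l\<in>J. a i j * a k j * a i l * a k l)"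
    by (simp add: power2_eq_square sum_product mult.assoc)
  also have "(\<Sum>i\<in>J. 2 * (\<Sum>j\<in>J. a i j * a i j)) = 2 * (\<Sum>i\<in>J. \<Sum>j\<in>J. (a i j)\<^sup>2)"
    by (simp add: sum_distrib_left power2_eq_square)
  finally show ?thesis .
qed

text \<open>
  For a square matrix M the matrices M M^T - I and M^T M - I have the same Frobenius norm: the
  quartic terms agree by reordering the four summations, the quadratic ones by exchanging the two
  indices, and both identity matrices have the same trace. This transfers information
  on the columns of M to its rows without inverting M.
\<close>
lemma gram_defect_transpose:
  fixes a :: "'i \<Rightarrow> 'i \<Rightarrow> real"
  assumes "finite J"
  shows "(\<Sum>i\<in>J. \<Sum>k\<in>J. ((\<Sum>j\<in>J. a i j * a k j) - (if i = k then 1 else 0))\<^sup>2)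
       = (\<Sum>i\<in>J. \<Sum>k\<in>J. ((\<Sum>j\<in>J. a j i * a j k) - (if i = k then 1 else 0))\<^sup>2)"
proof -
  have "(\<Sum>i\<in>J. \<Sum>k\<in>J. \<Sum>j\<in>J. \<Sum>l\<in>J. a i j * a k j * a i l * a k l)
      = (\<Sum>i\<in>J. \<Sum>j\<in>J. \<Sum>k\<in>J. \<Sum>l\<in>J. a i j * a k j * a i l * a k l)"
    by (intro sum.cong refl sum.swap)
  also have "\<dots> = (\<Sum>j\<in>J. \<Sum>i\<in>J. \<Sum>k\<in>J. \<Sum>l\<in>J. a i j * a k j * a i l * a k l)"
    by (rule sum.swap)
  also have "\<dots> = (\<Sum>j\<in>J. \<Sum>i\<in>J. \<Sum>l\<in>J. \<Sum>k\<in>J. a i j * a k j * a i l * a k l)"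
    by (intro sum.cong refl sum.swap)
  also have "\<dots> = (\<Sum>j\<in>J. \<Sum>l\<in>J. \<Sum>i\<in>J. \<Sum>k\<in>J. a i j * a k j * a i l * a k l)"
    by (intro sum.cong refl sum.swap)
  also have "\<dots> = (\<Sum>j\<in>J. \<Sum>l\<in>J. \<Sum>i\<in>J. \<Sum>k\<in>J. a i j * a i l * a k j * a k l)"
    by (intro sum.cong refl) (simp add: algebra_simps)
  finally have quartic: "(\<Sum>i\<in>J. \<Sum>k\<in>J. \<Sum>j\<in>J. \<Sum>l\<in>J. a i j * a k j * a i l * a k l) = \<dots>" .
  have quadratic: "(\<Sum>i\<in>J. \<Sum>j\<in>J. (a i j)\<^sup>2) = (\<Sum>i\<in>J. \<Sum>j\<in>J. (a j i)\<^sup>2)"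
    by (rule sum.swap)
  show ?thesis
    unfolding gram_defect_expansion[OF assms]
      gram_defect_expansion[OF assms, where a = "\<lambda>i j. a j i"] quartic quadratic ..
qed

text \<open>
  The difference of the two sums is the pairing of M M^T - I with the Gram matrix of the vectors
  y. The Frobenius norm of the former is at most 1/2, because M^T M - I has card J squared entries
  of size at most 1/(2 card J) each; that of the latter is at most the sum of the squared norms.
  The argument applies to vectors y in any inner product space, so it serves both for the scalar
  residuals and for the vector-valued gradient jumps.
\<close>
lemma almost_orthogonal_sum_squares:
  fixes m :: "'i \<Rightarrow> 'i \<Rightarrow> real" and y :: "'i \<Rightarrow> 'b::real_inner"
  assumes J: "finite J" "J \<noteq> {}"
    and gram: "\<And>j k. j \<in> J \<Longrightarrow> k \<in> J \<Longrightarrow>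
        \<bar>(\<Sum>i\<in>J. m i j * m i k) - (if j = k then 1 else 0)\<bar> \<le> 1 / (2 * real (card J))"
  shows "\<bar>(\<Sum>j\<in>J. (norm (\<Sum>i\<in>J. m i j *\<^sub>R y i))\<^sup>2) - (\<Sum>i\<in>J. (norm (y i))\<^sup>2)\<bar>
           \<le> (\<Sum>i\<in>J. (norm (y i))\<^sup>2) / 2"
proof -
  define d where "d i k = (\<Sum>j\<in>J. m i j * m k j) - (if i = k then 1 else 0)" for i k
  define S where "S = (\<Sum>i\<in>J. (norm (y i))\<^sup>2)"
  have "(\<Sum>j\<in>J. (norm (\<Sum>i\<in>J. m i j *\<^sub>R y i))\<^sup>2)
      = (\<Sum>j\<in>J. \<Sum>i\<in>J. \<Sum>k\<in>J. m i j * m k j * (y i \<bullet> y k))"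
    by (simp add: power2_norm_eq_inner inner_sum_left inner_sum_right sum_distrib_left mult.assoc)
       (simp add: mult.left_commute inner_commute)
  also have "\<dots> = (\<Sum>i\<in>J. \<Sum>k\<in>J. \<Sum>j\<in>J. m i j * m k j * (y i \<bullet> y k))"
    by (subst sum.swap) (intro sum.cong refl sum.swap)
  also have "\<dots> = (\<Sum>i\<in>J. \<Sum>k\<in>J. d i k * (y i \<bullet> y k) + (if i = k then y i \<bullet> y k else 0))"
    by (intro sum.cong refl) (auto simp: d_def sum_distrib_right left_diff_distrib)
  also have "\<dots> = (\<Sum>i\<in>J. \<Sum>k\<in>J. d i k * (y i \<bullet> y k)) + S"
    using J(1) by (simp add: sum.distrib S_def power2_norm_eq_inner)
  finally have diff: "(\<Sum>j\<in>J. (norm (\<Sum>i\<in>J. m i j *\<^sub>R y i))\<^sup>2) - S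
      = (\<Sum>(i,k)\<in>J\<times>J. d i k * (y i \<bullet> y k))" by (simp add: sum.cartesian_product)
  have "(\<Sum>(i,k)\<in>J\<times>J. (d i k)\<^sup>2) = (\<Sum>i\<in>J. \<Sum>k\<in>J. (d i k)\<^sup>2)"
    by (simp add: sum.cartesian_product)
  also have "\<dots> = (\<Sum>j\<in>J. \<Sum>k\<in>J. ((\<Sum>i\<in>J. m i j * m i k) - (if j = k then 1 else 0))\<^sup>2)"
    unfolding d_def by (rule gram_defect_transpose[OF J(1)])
  also have "\<dots> \<le> (\<Sum>j\<in>J. \<Sum>k\<in>J. (1 / (2 * real (card J)))\<^sup>2)"
    using gram by (intro sum_mono) (simp add: abs_le_square_iff[symmetric])
  also have "\<dots> = (1/2)\<^sup>2"
    using J by (simp add: power2_eq_square)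
  finally have frobenius: "(\<Sum>(i,k)\<in>J\<times>J. (d i k)\<^sup>2) \<le> (1/2)\<^sup>2" .
  have "(\<Sum>(i,k)\<in>J\<times>J. (y i \<bullet> y k)\<^sup>2) \<le> (\<Sum>(i,k)\<in>J\<times>J. (norm (y i))\<^sup>2 * (norm (y k))\<^sup>2)"
    by (intro sum_mono) (auto simp: power2_norm_eq_inner Cauchy_Schwarz_ineq)
  also have "\<dots> = S\<^sup>2"
    by (simp add: S_def power2_eq_square[of "sum _ _"] sum_product sum.cartesian_product)
  finally have rank1: "(\<Sum>(i,k)\<in>J\<times>J. (y i \<bullet> y k)\<^sup>2) \<le> S\<^sup>2" .
  have "(\<Sum>(i,k)\<in>J\<times>J. d i k * (y i \<bullet> y k))\<^sup>2
      \<le> (\<Sum>(i,k)\<in>J\<times>J. (d i k)\<^sup>2) * (\<Sum>(i,k)\<in>J\<times>J. (y i \<bullet> y k)\<^sup>2)"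
    using Cauchy_Schwarz_ineq_sum[of "\<lambda>(i,k). d i k" "\<lambda>(i,k). y i \<bullet> y k" "J \<times> J"]
    by (simp add: case_prod_unfold)
  also have "\<dots> \<le> (1/2)\<^sup>2 * S\<^sup>2"
    using frobenius rank1 by (intro mult_mono) (auto intro!: sum_nonneg)
  finally have "(\<Sum>(i,k)\<in>J\<times>J. d i k * (y i \<bullet> y k))\<^sup>2 \<le> (S/2)\<^sup>2"
    by (simp add: power_divide)
  moreover have "0 \<le> S" by (simp add: S_def sum_nonneg)
  ultimately have "\<bar>\<Sum>(i,k)\<in>J\<times>J. d i k * (y i \<bullet> y k)\<bar> \<le> S / 2"
    by (simp add: abs_le_square_iff[symmetric])
  then show ?thesis unfolding S_def[symmetric] diff .
qed

text \<open>
  The pointwise estimate survives integration, since integrability of the products of the f i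
  gives, by expanding squares, that of the squares of all their linear combinations.
\<close>
lemma almost_orthogonal_integral:
  fixes m :: "'i \<Rightarrow> 'i \<Rightarrow> real" and f g :: "'i \<Rightarrow> 'a \<Rightarrow> 'b::real_inner"
  assumes J: "finite J" "J \<noteq> {}"
    and gram: "\<And>j k. j \<in> J \<Longrightarrow> k \<in> J \<Longrightarrow>
        \<bar>(\<Sum>i\<in>J. m i j * m i k) - (if j = k then 1 else 0)\<bar> \<le> 1 / (2 * real (card J))"
    and int: "\<And>i k. i \<in> J \<Longrightarrow> k \<in> J \<Longrightarrow> integrable M (\<lambda>x. f i x \<bullet> f k x)"
    and g: "\<And>j x. j \<in> J \<Longrightarrow> x \<in> space M \<Longrightarrow> g j x = (\<Sum>i\<in>J. m i j *\<^sub>R f i x)"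
  shows "\<bar>(\<Sum>j\<in>J. LINT x|M. (norm (g j x))\<^sup>2) - (\<Sum>i\<in>J. LINT x|M. (norm (f i x))\<^sup>2)\<bar>
           \<le> (\<Sum>i\<in>J. LINT x|M. (norm (f i x))\<^sup>2) / 2"
proof -
  have intf: "integrable M (\<lambda>x. (norm (f i x))\<^sup>2)" if "i \<in> J" for i
    using int[OF that that] by (simp add: power2_norm_eq_inner)
  have "integrable M (\<lambda>x. \<Sum>i\<in>J. \<Sum>k\<in>J. m i j * (m k j * (f k x \<bullet> f i x)))" for j
    using int by (intro Bochner_Integration.integrable_sum integrable_mult_right) auto
  then have intg: "integrable M (\<lambda>x. (norm (\<Sum>i\<in>J. m i j *\<^sub>R f i x))\<^sup>2)" for j
    by (simp add: power2_norm_eq_inner inner_sum_left inner_sum_right sum_distrib_left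
          mult.left_commute)
  have "(\<Sum>j\<in>J. LINT x|M. (norm (g j x))\<^sup>2) - (\<Sum>i\<in>J. LINT x|M. (norm (f i x))\<^sup>2)
      = (\<Sum>j\<in>J. LINT x|M. (norm (\<Sum>i\<in>J. m i j *\<^sub>R f i x))\<^sup>2) - (\<Sum>i\<in>J. LINT x|M. (norm (f i x))\<^sup>2)"
    using g by (intro arg_cong2[of _ _ _ _ "(-)"] sum.cong refl Bochner_Integration.integral_cong) auto
  also have "\<dots> = (LINT x|M. (\<Sum>j\<in>J. (norm (\<Sum>i\<in>J. m i j *\<^sub>R f i x))\<^sup>2) - (\<Sum>i\<in>J. (norm (f i x))\<^sup>2))"
    using intf intg by (simp add: Bochner_Integration.integral_diff)
  also have "\<bar>\<dots>\<bar> \<le> (LINT x|M. (\<Sum>i\<in>J. (norm (f i x))\<^sup>2) / 2)"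
    using intf almost_orthogonal_sum_squares[OF J gram]
    by (intro order_trans[OF integral_abs_bound] integral_mono)
       (auto intro!: Bochner_Integration.integrable_diff integrable_abs Bochner_Integration.integrable_sum intg)
  also have "\<dots> = (\<Sum>i\<in>J. LINT x|M. (norm (f i x))\<^sup>2) / 2"
    using intf by simp
  finally show ?thesis .
qed

section \<open>The L2 inner product and Gram matrices\<close>
lemma L2_mult_integrable:
  fixes f g :: "real^'n \<Rightarrow> real"
  assumes "f \<in> L2 D" "g \<in> L2 D"
  shows "integrable (lebesgue_on D) (\<lambda>x. f x * g x)"
proof (rule Bochner_Integration.integrable_bound)
  show "integrable (lebesgue_on D) (\<lambda>x. (norm (f x))\<^sup>2 + (norm (g x))\<^sup>2)"
    using assms by (simp add: L2_def)
  show "(\<lambda>x. f x * g x) \<in> borel_measurable (lebesgue_on D)"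
    using assms by (auto simp: L2_def)
  have "\<bar>a * b\<bar> \<le> a\<^sup>2 + b\<^sup>2" for a b :: real
  proof -
    have "2 * \<bar>a * b\<bar> \<le> a\<^sup>2 + b\<^sup>2"
      using sum_squares_bound[of "\<bar>a\<bar>" "\<bar>b\<bar>"] by (simp add: abs_mult)
    then show ?thesis by linarith
  qed
  then show "AE x in lebesgue_on D. norm (f x * g x) \<le> norm ((norm (f x))\<^sup>2 + (norm (g x))\<^sup>2)"
    by auto
qed

lemma L2_add_scaled:
  fixes f g :: "real^'n \<Rightarrow> real"
  assumes "f \<in> L2 D" "g \<in> L2 D"
  shows "(\<lambda>x. f x + c * g x) \<in> L2 D"
proof -
  have "integrable (lebesgue_on D) (\<lambda>x. f x * f x + 2 * c * (f x * g x) + c\<^sup>2 * (g x * g x))"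
    using assms by (intro Bochner_Integration.integrable_add integrable_mult_right L2_mult_integrable)
  then have "integrable (lebesgue_on D) (\<lambda>x. (norm (f x + c * g x))\<^sup>2)"
    by (simp add: power2_eq_square algebra_simps)
  then show ?thesis using assms by (auto simp: L2_def)
qed

lemma L2_inner_commute: "L2_inner D f g = L2_inner D g f"
  by (simp add: L2_inner_def mult.commute)

lemma L2_inner_sum_left:
  fixes f :: "'i \<Rightarrow> real^'n \<Rightarrow> real"
  assumes "\<And>i. i \<in> I \<Longrightarrow> f i \<in> L2 D" "g \<in> L2 D"
  shows "L2_inner D (\<lambda>x. \<Sum>i\<in>I. c i * f i x) g = (\<Sum>i\<in>I. c i * L2_inner D (f i) g)"
proof -
  have "L2_inner D (\<lambda>x. \<Sum>i\<in>I. c i * f i x) g = (LINT x|lebesgue_on D. (\<Sum>i\<in>I. c i * (f i x * g x)))"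
    by (simp add: L2_inner_def sum_distrib_right mult.assoc)
  also have "\<dots> = (\<Sum>i\<in>I. c i * L2_inner D (f i) g)"
    using assms by (subst Bochner_Integration.integral_sum) (auto simp: L2_inner_def L2_mult_integrable)
  finally show ?thesis .
qed

lemma L2_inner_add_scaled_left:
  fixes f g h :: "real^'n \<Rightarrow> real"
  assumes "f \<in> L2 D" "g \<in> L2 D" "h \<in> L2 D"
  shows "L2_inner D (\<lambda>x. f x + c * g x) h = L2_inner D f h + c * L2_inner D g h"
proof -
  have "L2_inner D (\<lambda>x. f x + c * g x) h = (LINT x|lebesgue_on D. f x * h x + c * (g x * h x))"
    by (simp add: L2_inner_def algebra_simps)
  then show ?thesis using assms by (simp add: L2_inner_def L2_mult_integrable)
qed

lemma L2_inner_add_scaled_right: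
  fixes f g h :: "real^'n \<Rightarrow> real"
  assumes "f \<in> L2 D" "g \<in> L2 D" "h \<in> L2 D"
  shows "L2_inner D h (\<lambda>x. f x + c * g x) = L2_inner D h f + c * L2_inner D h g"
  using L2_inner_add_scaled_left[OF assms, of c] by (simp add: L2_inner_commute[of D h])

lemma L2_norm_power2: "(L2_norm D f)\<^sup>2 = (LINT x|lebesgue_on D. (norm (f x))\<^sup>2)"
  by (simp add: L2_norm_def)

lemma L2_norm_nonneg: "0 \<le> L2_norm D f"
  by (simp add: L2_norm_def)

lemma L2_inner_self: "L2_inner D f f = (L2_norm D f)\<^sup>2" for f :: "real^'n \<Rightarrow> real"
  unfolding L2_norm_power2 by (simp add: L2_inner_def power2_eq_square)

lemma nonneg_quadratic_discriminant:
  fixes a b c :: real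
  assumes nonneg: "\<And>t. 0 \<le> a + 2 * t * b + t\<^sup>2 * c" and c: "c \<ge> 0"
  shows "b\<^sup>2 \<le> a * c"
proof (cases "c = 0")
  case True
  have "b = 0"
  proof (rule ccontr)
    assume "b \<noteq> 0"
    then have "2 * (- (a + 1) / (2 * b)) * b = - (a + 1)" by (simp add: field_simps)
    then show False using nonneg[of "- (a + 1) / (2 * b)"] True by simp
  qed
  then show ?thesis using True by simp
next
  case False
  have vertex: "(- b / c)\<^sup>2 * c = b\<^sup>2 / c" "2 * (- b / c) * b = - 2 * (b\<^sup>2 / c)"
    using False by (simp_all add: power2_eq_square)
  have "0 \<le> a + - 2 * (b\<^sup>2 / c) + b\<^sup>2 / c" using nonneg[of "- b / c"] by (simp only: vertex)
  then have "b\<^sup>2 / c \<le> a" by linarith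
  then show ?thesis using False c by (simp add: pos_divide_le_eq)
qed

lemma L2_Cauchy_Schwarz:
  fixes f g :: "real^'n \<Rightarrow> real"
  assumes "f \<in> L2 D" "g \<in> L2 D"
  shows "\<bar>L2_inner D f g\<bar> \<le> L2_norm D f * L2_norm D g"
proof -
  have quadratic: "0 \<le> (L2_norm D f)\<^sup>2 + 2 * t * L2_inner D f g + t\<^sup>2 * (L2_norm D g)\<^sup>2" for t
  proof -
    have "L2_inner D (\<lambda>x. f x + t * g x) (\<lambda>x. f x + t * g x)
        = L2_inner D f f + t * L2_inner D g f + t * (L2_inner D f g + t * L2_inner D g g)"
      using assms L2_add_scaled[OF assms, of t]
      by (simp add: L2_inner_add_scaled_left L2_inner_add_scaled_right algebra_simps)
    also have "\<dots> = (L2_norm D f)\<^sup>2 + 2 * t * L2_inner D f g + t\<^sup>2 * (L2_norm D g)\<^sup>2"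
      unfolding L2_inner_self[symmetric] by (simp add: L2_inner_commute[of D g f] power2_eq_square algebra_simps)
    finally have "L2_inner D (\<lambda>x. f x + t * g x) (\<lambda>x. f x + t * g x)
        = (L2_norm D f)\<^sup>2 + 2 * t * L2_inner D f g + t\<^sup>2 * (L2_norm D g)\<^sup>2" .
    then show ?thesis
      using zero_le_power2[of "L2_norm D (\<lambda>x. f x + t * g x)"] by (simp only: L2_inner_self)
  qed
  have "(L2_inner D f g)\<^sup>2 \<le> (L2_norm D f)\<^sup>2 * (L2_norm D g)\<^sup>2"
    using quadratic by (intro nonneg_quadratic_discriminant) auto
  then show ?thesis
    using L2_norm_nonneg[of D f] L2_norm_nonneg[of D g]
    by (simp add: power_mult_distrib[symmetric] abs_le_square_iff[symmetric] abs_mult)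
qed

text \<open>
  Writing f = u - d, the Gram matrix of f differs from that of u by the two mixed terms (u j, d k)
  and (d j, u k), of size at most e each, and by (d j, d k), of size at most e squared.
  The total 2 e + e^2 is (1 + e)^2 - 1.
\<close>
lemma gram_of_perturbed_orthonormal:
  fixes u f :: "nat \<Rightarrow> real^'n \<Rightarrow> real"
  assumes J: "L2_orthonormal_on D J u" "j \<in> J" "k \<in> J"
    and L2: "\<And>i. i \<in> J \<Longrightarrow> u i \<in> L2 D" "\<And>i. i \<in> J \<Longrightarrow> f i \<in> L2 D"
    and e: "\<And>i. i \<in> J \<Longrightarrow> L2_norm D (\<lambda>x. u i x - f i x) \<le> e"
  shows "\<bar>L2_inner D (f j) (f k) - (if j = k then 1 else 0)\<bar> \<le> (1 + e)\<^sup>2 - 1"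
proof -
  define d where "d i = (\<lambda>x. u i x - f i x)" for i
  have d: "d i \<in> L2 D" "L2_norm D (d i) \<le> e" if "i \<in> J" for i
    using L2_add_scaled[OF L2(1)[OF that] L2(2)[OF that], of "-1"] e[OF that] by (simp_all add: d_def)
  have norm_u: "L2_norm D (u i) = 1" if "i \<in> J" for i
  proof -
    have "(L2_norm D (u i))\<^sup>2 = 1"
      using J(1) that by (simp add: L2_orthonormal_on_def L2_inner_self[symmetric])
    then show ?thesis using L2_norm_nonneg[of D "u i"] by (simp add: power2_eq_1_iff)
  qed
  have f: "f i = (\<lambda>x. u i x + (-1) * d i x)" for i by (auto simp: d_def)
  have "L2_inner D (\<lambda>x. u j x + c * d j x) (\<lambda>x. u k x + c * d k x)
      = L2_inner D (u j) (u k) + c * L2_inner D (u j) (d k)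
        + c * (L2_inner D (d j) (u k) + c * L2_inner D (d j) (d k))" for c
    using L2(1)[OF J(2)] L2(1)[OF J(3)] d(1)[OF J(2)] d(1)[OF J(3)]
    by (simp add: L2_inner_add_scaled_left L2_inner_add_scaled_right L2_add_scaled)
  from this[of "-1"] have "L2_inner D (f j) (f k) = L2_inner D (u j) (u k) - L2_inner D (u j) (d k)
      - L2_inner D (d j) (u k) + L2_inner D (d j) (d k)"
    unfolding f[symmetric] by simp
  then have "L2_inner D (f j) (f k) - (if j = k then 1 else 0)
      = L2_inner D (d j) (d k) - L2_inner D (u j) (d k) - L2_inner D (d j) (u k)"
    using J by (simp add: L2_orthonormal_on_def)
  moreover have "\<bar>L2_inner D (d j) (d k)\<bar> \<le> e * e"
    using d[OF J(2)] d[OF J(3)] L2_norm_nonneg[of D "d j"] L2_norm_nonneg[of D "d k"]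
    by (intro order_trans[OF L2_Cauchy_Schwarz] mult_mono) auto
  moreover have "\<bar>L2_inner D (u j) (d k)\<bar> \<le> e"
    using L2_Cauchy_Schwarz[OF L2(1)[OF J(2)] d(1)[OF J(3)]] norm_u[OF J(2)] d(2)[OF J(3)] by simp
  moreover have "\<bar>L2_inner D (d j) (u k)\<bar> \<le> e"
    using L2_Cauchy_Schwarz[OF d(1)[OF J(2)] L2(1)[OF J(3)]] norm_u[OF J(3)] d(2)[OF J(2)] by simp
  ultimately show ?thesis by (simp add: power2_eq_square algebra_simps)
qed

section \<open>Derivatives within an element\<close>
text \<open>
  At a corner of a simplex a segment in a coordinate direction may leave the simplex at once, so
  uniqueness cannot be read off the partial derivatives. But all segments from x to points y of K
  stay in K and determine the derivative on y - x; since K contains a ball, these differences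
  span the whole space.
\<close>
lemma has_derivative_within_convex_unique:
  fixes f :: "'a::euclidean_space \<Rightarrow> 'b::real_normed_vector"
  assumes K: "convex K" "interior K \<noteq> {}" and x: "x \<in> K"
    and A: "(f has_derivative A) (at x within K)" and B: "(f has_derivative B) (at x within K)"
  shows "A = B"
proof -
  define D where "D h = A h - B h" for h
  have D: "((\<lambda>_. 0) has_derivative D) (at x within K)"
    using has_derivative_diff[OF A B] by (simp add: D_def[abs_def])
  interpret D: linear D by (rule has_derivative_linear[OF D])
  \<comment> \<open>restrict to the segment from x to y, where one-variable uniqueness applies\<close>
  have chord: "D (y - x) = 0" if "y \<in> K" for y
  proof -
    have "(\<lambda>t::real. x + t *\<^sub>R (y - x)) ` {0..1} \<subseteq> K"
      using K(1) x that by (auto simp: convex_alt algebra_simps)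
    then have "((\<lambda>_. 0) has_derivative D) (at (x + 0 *\<^sub>R (y - x)) within (\<lambda>t::real. x + t *\<^sub>R (y - x)) ` {0..1})"
      using has_derivative_subset[OF D] by simp
    moreover have "((\<lambda>t::real. x + t *\<^sub>R (y - x)) has_derivative (\<lambda>t. t *\<^sub>R (y - x))) (at 0 within {0..1})"
      by (auto intro!: derivative_eq_intros)
    ultimately have "((\<lambda>_. 0) has_derivative (\<lambda>t. D (t *\<^sub>R (y - x)))) (at 0 within {0..1::real})"
      using has_derivative_in_compose[of "\<lambda>t::real. x + t *\<^sub>R (y - x)" _ 0 "{0..1}" "\<lambda>_. 0::'b" D] by simp
    then have "((\<lambda>_. 0) has_vector_derivative D (y - x)) (at 0 within {0..1::real})"
      by (simp add: has_vector_derivative_def D.scale)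
    moreover have "((\<lambda>_. 0) has_vector_derivative 0) (at 0 within {0..1::real})"
      by (rule has_vector_derivative_const)
    ultimately show ?thesis
      using vector_derivative_unique_within_closed_interval[of 0 1 "0::real" "\<lambda>_. 0::'b" "D (y - x)" 0] by simp
  qed
  obtain c e where e: "e > 0" "ball c e \<subseteq> K"
    using K(2) by (meson all_not_in_conv mem_interior)
  have "D h = 0" for h
  proof (cases "h = 0")
    case False
    \<comment> \<open>any direction h is a multiple of a difference of two points of the ball around c\<close>
    define s where "s = e / (2 * norm h)"
    have s: "s \<noteq> 0" "c + s *\<^sub>R h \<in> K" "c \<in> K"
      using e False by (auto simp: s_def dist_norm intro!: subsetD[OF e(2)])
    have "s *\<^sub>R D h = D (c + s *\<^sub>R h - x) - D (c - x)"
      by (simp add: D.add D.diff D.scale)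
    then show ?thesis using chord s by simp
  qed (simp add: D.zero)
  then show ?thesis by (auto simp: D_def)
qed

lemma gradient_within_sum:
  fixes f :: "'i \<Rightarrow> real^'n \<Rightarrow> real"
  assumes K: "convex K" "interior K \<noteq> {}" "x \<in> K"
    and f: "\<And>i. i \<in> I \<Longrightarrow> f i differentiable (at x within K)"
  shows "gradient_within K (\<lambda>y. \<Sum>i\<in>I. c i * f i y) x = (\<Sum>i\<in>I. c i *\<^sub>R gradient_within K (f i) x)"
proof -
  let ?D = "\<lambda>h. \<Sum>i\<in>I. c i * frechet_derivative (f i) (at x within K) h"
  have D: "((\<lambda>y. \<Sum>i\<in>I. c i * f i y) has_derivative ?D) (at x within K)"
    using f by (intro has_derivative_sum has_derivative_mult_right) (simp add: frechet_derivative_works[symmetric])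
  then have "frechet_derivative (\<lambda>y. \<Sum>i\<in>I. c i * f i y) (at x within K) = ?D"
    using has_derivative_within_convex_unique[OF K] frechet_derivative_works differentiableI by blast
  then show ?thesis by (simp add: gradient_within_def vec_eq_iff sum_component)
qed

lemma laplacian_within_sum:
  fixes f :: "'i \<Rightarrow> real^'n \<Rightarrow> real"
  assumes K: "convex K" "interior K \<noteq> {}" "x \<in> K"
    and f: "\<And>i. i \<in> I \<Longrightarrow> f i differentiable_on K"
    and g: "\<And>i. i \<in> I \<Longrightarrow> gradient_within K (f i) differentiable_on K"
  shows "laplacian_within K (\<lambda>y. \<Sum>i\<in>I. c i * f i y) x = (\<Sum>i\<in>I. c i * laplacian_within K (f i) x)"
proof -
  let ?D = "\<lambda>h. \<Sum>i\<in>I. c i *\<^sub>R frechet_derivative (gradient_within K (f i)) (at x within K) h"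
  have "((\<lambda>y. \<Sum>i\<in>I. c i *\<^sub>R gradient_within K (f i) y) has_derivative ?D) (at x within K)"
    using g K(3) by (intro has_derivative_sum has_derivative_scaleR_right)
      (simp add: frechet_derivative_works[symmetric] differentiable_on_def)
  moreover have "gradient_within K (\<lambda>y. \<Sum>i\<in>I. c i * f i y) y = (\<Sum>i\<in>I. c i *\<^sub>R gradient_within K (f i) y)"
    if "y \<in> K" for y
    using gradient_within_sum[OF K(1,2) that, of I f c] f that by (simp add: differentiable_on_def)
  ultimately have D: "(gradient_within K (\<lambda>y. \<Sum>i\<in>I. c i * f i y) has_derivative ?D) (at x within K)"
    by (rule has_derivative_transform[OF K(3), rotated])
  then have "frechet_derivative (gradient_within K (\<lambda>y. \<Sum>i\<in>I. c i * f i y)) (at x within K) = ?D"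
    using has_derivative_within_convex_unique[OF K] frechet_derivative_works differentiableI by blast
  then show ?thesis
    by (simp add: laplacian_within_def sum_component sum_distrib_left) (rule sum.swap)
qed

lemma poly_deg_le_real_polynomial_function:
  assumes "poly_deg_le r p"
  shows "real_polynomial_function p"
proof -
  obtain c where c: "p = (\<lambda>x. \<Sum>\<alpha> | sum \<alpha> UNIV \<le> r. c \<alpha> * (\<Prod>i\<in>UNIV. (x $ i) ^ \<alpha> i))"
    using assms unfolding poly_deg_le_def by auto
  have "real_polynomial_function (\<lambda>x::real^'a. x $ i)" for i
    by (intro real_polynomial_function.intros(1) bounded_linear_vec_nth)
  then have "real_polynomial_function (\<lambda>x. c \<alpha> * (\<Prod>i\<in>UNIV. (x $ i) ^ \<alpha> i))" for \<alpha>
    by (intro real_polynomial_function.intros(4) real_polynomial_function.intros(2)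
        real_polynomial_function_prod real_polynomial_function_power) auto
  then show ?thesis
    unfolding c by (cases "finite {\<alpha>::'a \<Rightarrow> nat. sum \<alpha> UNIV \<le> r}") auto
qed

text \<open>
  Stated with polynomial components so that it can be applied to the components of q again,
  which yields the second derivatives.
\<close>
lemma real_polynomial_function_gradient:
  fixes p :: "real^'n \<Rightarrow> real"
  assumes "real_polynomial_function p"
  shows "\<exists>q. (\<forall>i. real_polynomial_function (\<lambda>x. q x $ i))
           \<and> (\<forall>x. (p has_derivative (\<lambda>h. q x \<bullet> h)) (at x))"
  using assms
proof (induction rule: real_polynomial_function.induct)
  case (linear f)
  interpret bounded_linear f by fact
  have "f h = (\<chi> i. f (axis i 1)) \<bullet> h" for h
  proof -
    have "f h = f (\<Sum>i\<in>UNIV. (h $ i) *\<^sub>R axis i 1)"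
      using basis_expansion[of h] by (simp add: scalar_mult_eq_scaleR)
    then show ?thesis by (simp add: sum scaleR inner_vec_def mult.commute)
  qed
  then have "f = (\<lambda>h. (\<chi> i. f (axis i 1)) \<bullet> h)" by (rule ext)
  moreover have "(f has_derivative f) (at x)" for x
    by (rule has_derivative[OF has_derivative_ident])
  ultimately have "(f has_derivative (\<lambda>h. (\<chi> i. f (axis i 1)) \<bullet> h)) (at x)" for x
    by metis
  then show ?case
    by (intro exI[of _ "\<lambda>_. \<chi> i. f (axis i 1)"]) (simp add: real_polynomial_function.intros(2))
next
  case (const c)
  show ?case by (rule exI[of _ "\<lambda>_. 0"]) auto
next
  case (add f g)
  then obtain qf qg where q:
    "\<And>i. real_polynomial_function (\<lambda>x. qf x $ i)" "\<And>x. (f has_derivative (\<lambda>h. qf x \<bullet> h)) (at x)"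
    "\<And>i. real_polynomial_function (\<lambda>x. qg x $ i)" "\<And>x. (g has_derivative (\<lambda>h. qg x \<bullet> h)) (at x)"
    by auto
  show ?case
  proof (intro exI[of _ "\<lambda>x. qf x + qg x"] conjI allI)
    show "real_polynomial_function (\<lambda>x. (qf x + qg x) $ i)" for i
      using q by (simp add: real_polynomial_function.intros(3))
    show "((\<lambda>x. f x + g x) has_derivative (\<lambda>h. (qf x + qg x) \<bullet> h)) (at x)" for x
      using has_derivative_add[OF q(2,4)] by (simp add: inner_add_left)
  qed
next
  case (mult f g)
  then obtain qf qg where q:
    "\<And>i. real_polynomial_function (\<lambda>x. qf x $ i)" "\<And>x. (f has_derivative (\<lambda>h. qf x \<bullet> h)) (at x)"
    "\<And>i. real_polynomial_function (\<lambda>x. qg x $ i)" "\<And>x. (g has_derivative (\<lambda>h. qg x \<bullet> h)) (at x)"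
    by auto
  show ?case
  proof (intro exI[of _ "\<lambda>x. f x *\<^sub>R qg x + g x *\<^sub>R qf x"] conjI allI)
    show "real_polynomial_function (\<lambda>x. (f x *\<^sub>R qg x + g x *\<^sub>R qf x) $ i)" for i
      using q mult by (simp add: real_polynomial_function.intros(3) real_polynomial_function.intros(4))
    show "((\<lambda>x. f x * g x) has_derivative (\<lambda>h. (f x *\<^sub>R qg x + g x *\<^sub>R qf x) \<bullet> h)) (at x)" for x
      using has_derivative_mult[OF q(2,4)] by (simp add: inner_add_left mult.commute)
  qed
qed

text \<open>
  By uniqueness of derivatives within K, the gradient and the Laplacian of v within K are the
  restrictions of those of the polynomial p, up to and including the boundary of K.
\<close>
lemma polynomial_on_element_regular:
  fixes v p :: "real^'n \<Rightarrow> real"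
  assumes K: "convex K" "interior K \<noteq> {}"
    and p: "real_polynomial_function p" and v: "\<And>x. x \<in> K \<Longrightarrow> v x = p x"
  shows "v differentiable_on K" "gradient_within K v differentiable_on K"
    "continuous_on K (laplacian_within K v)"
proof -
  obtain q where q: "\<And>i. real_polynomial_function (\<lambda>x. q x $ i)"
      "\<And>x. (p has_derivative (\<lambda>h. q x \<bullet> h)) (at x)"
    using real_polynomial_function_gradient[OF p] by auto
  obtain H where H: "\<And>i k. real_polynomial_function (\<lambda>x. H i x $ k)"
      "\<And>i x. ((\<lambda>x. q x $ i) has_derivative (\<lambda>h. H i x \<bullet> h)) (at x)"
    using real_polynomial_function_gradient[OF q(1)] by metis
  have v': "(v has_derivative (\<lambda>h. q x \<bullet> h)) (at x within K)" if "x \<in> K" for x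
    using has_derivative_transform[OF that v has_derivative_at_withinI[OF q(2)]] .
  then show "v differentiable_on K"
    unfolding differentiable_on_def using differentiableI by blast
  have grad: "gradient_within K v x = q x" if "x \<in> K" for x
  proof -
    have "frechet_derivative v (at x within K) = (\<lambda>h. q x \<bullet> h)"
      using has_derivative_within_convex_unique[OF K that] v'[OF that] frechet_derivative_works
        differentiableI by blast
    then show ?thesis by (simp add: gradient_within_def inner_axis vec_eq_iff)
  qed
  have q': "(q has_derivative (\<lambda>h. \<chi> i. H i x \<bullet> h)) (at x within K)" for x
    using has_derivative_at_withinI[OF H(2)]
    by (subst has_derivative_componentwise_within) (auto simp: Basis_vec_def inner_axis)
  have grad': "(gradient_within K v has_derivative (\<lambda>h. \<chi> i. H i x \<bullet> h)) (at x within K)"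
    if "x \<in> K" for x
    using has_derivative_transform[OF that grad q'] .
  then show "gradient_within K v differentiable_on K"
    unfolding differentiable_on_def using differentiableI by blast
  have "laplacian_within K v x = (\<Sum>i\<in>UNIV. H i x $ i)" if "x \<in> K" for x
  proof -
    have "frechet_derivative (gradient_within K v) (at x within K) = (\<lambda>h. \<chi> i. H i x \<bullet> h)"
      using has_derivative_within_convex_unique[OF K that] grad'[OF that] frechet_derivative_works
        differentiableI by blast
    then show ?thesis by (simp add: laplacian_within_def inner_axis)
  qed
  moreover have "continuous_on K (\<lambda>x. \<Sum>i\<in>UNIV. H i x $ i)"
    using H(1) differentiable_on_real_polynomial_function differentiable_imp_continuous_on
    by (intro continuous_on_sum) blast
  ultimately show "continuous_on K (laplacian_within K v)"
    by (simp cong: continuous_on_cong)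
qed

section \<open>Integrability on facets and elements\<close>
text \<open>
  The surface measure of a compact set F is finite: points of the slab that are projected
  into F lie within distance 1/2 of F, hence in a bounded set.
\<close>
lemma facet_set_integrable:
  fixes f :: "real^'n \<Rightarrow> real"
  assumes F: "compact F" "F \<noteq> {}" and f: "continuous_on F f"
  shows "set_integrable (hyperplane_measure (affine hull F)) F f"
proof -
  define H where "H = affine hull F"
  define M where "M = hyperplane_measure H"
  define S where "S = {y. infdist y H \<le> 1/2}"
  have H: "convex H" "closed H" "H \<noteq> {}"
    using F by (auto simp: H_def)
  have cp: "closest_point H \<in> borel_measurable borel"
    using continuous_on_closest_point[OF H] by (rule borel_measurable_continuous_onI)
  have S: "S \<in> sets borel"
    unfolding S_def by (intro borel_closed closed_Collect_le continuous_intros)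
  have F': "F \<in> sets borel" using F(1) by (rule borel_compact)
  have "bounded (S \<inter> closest_point H -` F)"
  proof -
    obtain a R where R: "\<And>z. z \<in> F \<Longrightarrow> dist a z \<le> R"
      using F(1) compact_imp_bounded unfolding bounded_def by blast
    have "dist a y \<le> R + 1/2" if "y \<in> S \<inter> closest_point H -` F" for y
    proof -
      have "dist y (closest_point H y) \<le> infdist y H"
        using H(2,3) by (auto simp: infdist_notempty intro!: cINF_greatest closest_point_le)
      then show ?thesis
        using that R[of "closest_point H y"] dist_triangle[of a y "closest_point H y"]
        by (simp add: S_def dist_commute)
    qed
    then show ?thesis unfolding bounded_def by blast
  qed
  then have "emeasure lborel (S \<inter> closest_point H -` F) < \<infinity>"
    by (rule emeasure_bounded_finite)
  moreover have "emeasure M F = emeasure lborel (S \<inter> closest_point H -` F)"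
  proof -
    have "closest_point H \<in> measurable (restrict_space lborel S) borel"
      using cp by (intro measurable_restrict_space1) simp
    then have "emeasure M F = emeasure (restrict_space lborel S) (closest_point H -` F \<inter> S)"
      using F' by (simp add: M_def hyperplane_measure_def S_def emeasure_distr space_restrict_space)
    also have "\<dots> = emeasure lborel (closest_point H -` F \<inter> S)"
      using S by (intro emeasure_restrict_space) auto
    finally show ?thesis by (simp add: Int_commute)
  qed
  ultimately have finite: "emeasure M F < \<infinity>" by simp
  obtain B where B: "\<And>x. x \<in> F \<Longrightarrow> norm (f x) \<le> B"
    using compact_imp_bounded[OF compact_continuous_image[OF f F(1)]] by (auto simp: bounded_iff)
  have sets: "sets M = sets borel" by (simp add: M_def hyperplane_measure_def)
  have "integrable M (\<lambda>x. indicator F x *\<^sub>R f x)"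
  proof (rule integrableI_bounded_set[where A = F and B = B])
    show "F \<in> sets M" using F' sets by simp
    show "(\<lambda>x. indicator F x *\<^sub>R f x) \<in> borel_measurable M"
      using borel_measurable_continuous_on_indicator[OF F' f] measurable_cong_sets[OF sets refl] by blast
    show "AE x in M. x \<in> F \<longrightarrow> norm (indicator F x *\<^sub>R f x) \<le> B" using B by auto
    show "AE x in M. x \<notin> F \<longrightarrow> indicator F x *\<^sub>R f x = 0" by auto
  qed (fact finite)
  then show ?thesis by (simp add: set_integrable_def M_def H_def)
qed

lemma continuous_compact_integrable:
  fixes f :: "real^'n \<Rightarrow> real"
  assumes "compact K" "continuous_on K f"
  shows "integrable (lebesgue_on K) f"
proof -
  have "integrable lebesgue (\<lambda>x. indicator K x *\<^sub>R f x)"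
    using borel_integrable_compact[OF assms] integrable_completion[of _ lborel] by fastforce
  moreover have "K \<in> sets lebesgue" using assms(1) lmeasurable_compact by blast
  ultimately show ?thesis by (simp add: integrable_restrict_space)
qed

section \<open>Spans and orthonormal expansions\<close>
lemma pointwise_vector_space: "vector_space (\<lambda>(c::real) (f :: 'a \<Rightarrow> real) x. c * f x)"
  unfolding vector_space_def by (auto simp: fun_eq_iff distrib_left distrib_right mult.assoc)

lemma fun_span_superset: "S \<subseteq> fun_span S"
proof -
  interpret vector_space "\<lambda>(c::real) (f :: 'a \<Rightarrow> real) x. c * f x"
    by (rule pointwise_vector_space)
  show ?thesis unfolding fun_span_def by (rule span_superset)
qed

lemma fun_span_mono:
  assumes "S \<subseteq> S'"
  shows "fun_span S \<subseteq> fun_span S'"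
proof -
  interpret vector_space "\<lambda>(c::real) (f :: 'a \<Rightarrow> real) x. c * f x"
    by (rule pointwise_vector_space)
  show ?thesis unfolding fun_span_def by (rule span_mono[OF assms])
qed

lemma fun_span_combination:
  fixes f :: "'i \<Rightarrow> 'a \<Rightarrow> real"
  assumes w: "w \<in> fun_span (f ` I)" and I: "finite I"
  shows "\<exists>c. w = (\<lambda>x. \<Sum>i\<in>I. c i * f i x)"
proof -
  interpret vector_space "\<lambda>(c::real) (f :: 'a \<Rightarrow> real) x. c * f x"
    by (rule pointwise_vector_space)
  have "w \<in> span (f ` I)" using w by (simp add: fun_span_def)
  moreover have "subspace {w. \<exists>c. w = (\<lambda>x. \<Sum>i\<in>I. c i * f i x)}" (is "subspace ?C")
    unfolding subspace_def
  proof (intro conjI ballI allI)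
    show "0 \<in> ?C"
      by (auto simp: zero_fun_def intro!: exI[of _ "\<lambda>_. 0"])
    fix v assume "v \<in> ?C"
    then obtain c where c: "v = (\<lambda>x. \<Sum>i\<in>I. c i * f i x)" by blast
    show "v + w \<in> ?C" if w: "w \<in> ?C" for w
    proof -
      obtain d where "w = (\<lambda>x. \<Sum>i\<in>I. d i * f i x)" using w by blast
      then have "v + w = (\<lambda>x. \<Sum>i\<in>I. (c i + d i) * f i x)"
        using c by (simp add: plus_fun_def distrib_right sum.distrib)
      then show ?thesis by (intro CollectI exI)
    qed
    show "(\<lambda>x. a * v x) \<in> ?C" for a
      unfolding c by (intro CollectI exI[of _ "\<lambda>i. a * c i"]) (simp add: sum_distrib_left mult.assoc)
  qed
  moreover have "\<exists>c. f k = (\<lambda>x. \<Sum>i\<in>I. c i * f i x)" if "k \<in> I" for k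
    using that I by (intro exI[of _ "\<lambda>i. if i = k then 1 else 0"]) (simp add: if_distrib[of "\<lambda>a. a * _"] cong: if_cong)
  ultimately show ?thesis
    using span_induct[of w "f ` I" "\<lambda>w. \<exists>c. w = (\<lambda>x. \<Sum>i\<in>I. c i * f i x)"] by blast
qed

lemma fun_dim_mono:
  assumes "V \<subseteq> V'" "fun_span (f ` {1..fun_dim V'}) = V'"
  shows "fun_dim V \<le> fun_dim V'"
proof -
  interpret vector_space "\<lambda>(c::real) (f :: 'a \<Rightarrow> real) x. c * f x"
    by (rule pointwise_vector_space)
  have "dim V \<le> card (f ` {1..fun_dim V'})"
  proof (rule dim_le_card)
    show "V \<subseteq> span (f ` {1..fun_dim V'})"
      using assms(1) by (simp only: fun_span_def[symmetric] assms(2))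
  qed simp
  also have "\<dots> \<le> fun_dim V'" using card_image_le[of "{1..fun_dim V'}" f] by simp
  finally show ?thesis by (simp add: fun_dim_def)
qed

text \<open>
  An identity of functions at every point, not only almost everywhere: the elements of a span are
  honest linear combinations, and only the coefficients are read off by integration. This is
  what allows expansions to be differentiated and to be restricted to facets, which are null sets.
\<close>
lemma orthonormal_expansion:
  fixes v :: "nat \<Rightarrow> real^'n \<Rightarrow> real"
  assumes v: "L2_orthonormal_on D I v" "\<And>i. i \<in> I \<Longrightarrow> v i \<in> L2 D" and I: "finite I"
    and w: "w \<in> fun_span (v ` I)"
  shows "w = (\<lambda>x. \<Sum>i\<in>I. L2_inner D w (v i) * v i x)"
proof -
  obtain c where c: "w = (\<lambda>x. \<Sum>i\<in>I. c i * v i x)"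
    using fun_span_combination[OF w I] by blast
  have "L2_inner D w (v k) = c k" if "k \<in> I" for k
  proof -
    have "L2_inner D w (v k) = (\<Sum>i\<in>I. c i * L2_inner D (v i) (v k))"
      unfolding c using v(2) that by (intro L2_inner_sum_left) auto
    also have "\<dots> = (\<Sum>i\<in>I. if i = k then c i else 0)"
      using v(1) that by (intro sum.cong) (auto simp: L2_orthonormal_on_def)
    finally show ?thesis using I that by simp
  qed
  then have "(\<lambda>x. \<Sum>i\<in>I. L2_inner D w (v i) * v i x) = (\<lambda>x. \<Sum>i\<in>I. c i * v i x)" by simp
  then show ?thesis unfolding c[symmetric] by (rule sym)
qed

section \<open>Nestedness of the refined meshes\<close>
lemma children_hull_subset:
  assumes t: "fst t \<noteq> []" and s: "s \<in> children t"
  shows "fst s \<noteq> []" "hull_of s \<subseteq> hull_of t"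
proof -
  define z where "z = fst t"
  let ?m = "midpoint (hd z) (last z)" and ?mid = "butlast (tl z)"
  have fst_s: "fst s = hd z # ?m # take (snd t) ?mid @ drop (snd t) ?mid
      \<or> fst s = last z # ?m # take (snd t) ?mid @ rev (drop (snd t) ?mid)"
    using s by (auto simp: children_def Let_def z_def)
  then show "fst s \<noteq> []" by auto
  have z: "z \<noteq> []" using t by (simp add: z_def)
  have "?m \<in> convex hull (set z)"
    unfolding midpoint_def scaleR_add_right
    using convexD[OF convex_convex_hull, of "hd z" "set z" "last z" "inverse 2" "inverse 2"]
      hull_inc[of "hd z" "set z" convex] hull_inc[of "last z" "set z" convex] z by simp
  moreover have "set ?mid \<subseteq> set z"
    using z by (meson in_set_butlastD list.set_sel(2) subsetI)
  moreover have "set (take (snd t) ?mid) \<subseteq> set ?mid" "set (drop (snd t) ?mid) \<subseteq> set ?mid"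
    by (rule set_take_subset, rule set_drop_subset)
  moreover have "set z \<subseteq> convex hull (set z)" by (rule hull_subset)
  moreover have "hd z \<in> set z" "last z \<in> set z" using z by auto
  ultimately have "set (fst s) \<subseteq> convex hull (set z)"
    using fst_s by (elim disjE) (simp_all, blast+)
  then show "hull_of s \<subseteq> hull_of t"
    unfolding hull_of_def z_def[symmetric] by (intro hull_minimal convex_convex_hull)
qed

text \<open>
  Intermediate meshes of a refinement need not be conforming, so the induction carries only that
  vertex lists are nonempty, which makes the endpoints of the refinement edge genuine vertices.
\<close>
lemma nvb_refinement_nested:
  assumes "nvb_refinement \<T> \<T>'" and "\<And>t. t \<in> \<T> \<Longrightarrow> wf_tagged_simplex t"
  shows "\<forall>K'\<in>elements \<T>'. \<exists>K\<in>elements \<T>. K' \<subseteq> K"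
proof -
  have "bisection_step\<^sup>*\<^sup>* \<T> \<T>'" using assms(1) by (simp add: nvb_refinement_def)
  then have "\<forall>t\<in>\<T>'. fst t \<noteq> [] \<and> (\<exists>s\<in>\<T>. hull_of t \<subseteq> hull_of s)"
  proof (induction rule: rtranclp_induct)
    case base
    then show ?case using assms(2) by (fastforce simp: wf_tagged_simplex_def)
  next
    case (step \<U> \<U>')
    then obtain p where p: "p \<in> \<U>" "\<U>' = (\<U> - {p}) \<union> children p"
      by (auto simp: bisection_step_def)
    show ?case
    proof
      fix t assume "t \<in> \<U>'"
      then consider "t \<in> \<U>" | "t \<in> children p" using p by auto
      then show "fst t \<noteq> [] \<and> (\<exists>s\<in>\<T>. hull_of t \<subseteq> hull_of s)"
      proof cases
        case 1
        then show ?thesis using step.IH by blast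
      next
        case 2
        have "fst p \<noteq> []" using step.IH p(1) by blast
        note sub = children_hull_subset[OF this 2]
        obtain s where "s \<in> \<T>" "hull_of p \<subseteq> hull_of s" using step.IH p(1) by blast
        then show ?thesis using sub by (meson order_trans)
      qed
    qed
  qed
  then show ?thesis by (auto simp: elements_def)
qed

lemma fe_space_mono:
  assumes "\<forall>K'\<in>\<K>'. \<exists>K\<in>\<K>. K' \<subseteq> K"
  shows "fe_space D \<K> r \<subseteq> fe_space D \<K>' r"
proof
  fix v assume v: "v \<in> fe_space D \<K> r"
  have "\<exists>p. poly_deg_le r p \<and> (\<forall>x\<in>K'. v x = p x)" if K': "K' \<in> \<K>'" for K'
  proof -
    obtain K where K: "K \<in> \<K>" "K' \<subseteq> K" using bspec[OF assms K'] by blast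
    then obtain p where "poly_deg_le r p" "\<forall>x\<in>K. v x = p x"
      using v unfolding fe_space_def by blast
    then show ?thesis using K(2) by blast
  qed
  then show "v \<in> fe_space D \<K>' r" using v by (simp add: fe_space_def)
qed

section \<open>Linearity and continuity of residuals and jumps\<close>
definition convex_body :: "(real^'n) set \<Rightarrow> bool" where
  "convex_body K \<longleftrightarrow> convex K \<and> compact K \<and> interior K \<noteq> {}"

lemma hull_of_convex_body:
  assumes "wf_tagged_simplex t"
  shows "convex_body (hull_of t)"
proof -
  have "card (set (fst t)) = Suc (DIM(real^'a))"
    using assms by (simp add: wf_tagged_simplex_def distinct_card)
  then have "interior (hull_of t) \<noteq> {}"
    using assms interior_convex_hull_eq_empty unfolding hull_of_def wf_tagged_simplex_def by blast
  then show ?thesis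
    by (simp add: convex_body_def hull_of_def finite_imp_compact_convex_hull)
qed

text \<open>
  The regularity of a finite element function on a single element that makes its one-sided
  derivatives linear under linear combinations and the integrals in the indicators finite.
  Differentiability is taken within the element, so it includes the boundary points where the
  traces entering the jumps are evaluated.
\<close>
definition laplace_regular :: "(real^'n) set \<Rightarrow> (real^'n \<Rightarrow> real) \<Rightarrow> bool" where
  "laplace_regular K v \<longleftrightarrow> v differentiable_on K \<and> gradient_within K v differentiable_on K
     \<and> continuous_on K (laplacian_within K v)"

lemma fe_space_laplace_regular:
  assumes "v \<in> fe_space D \<K> r" "K \<in> \<K>" "convex_body K"
  shows "laplace_regular K v"
proof -
  obtain p where p: "poly_deg_le r p" "\<And>x. x \<in> K \<Longrightarrow> v x = p x"
    using assms by (auto simp: fe_space_def)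
  show ?thesis
    unfolding laplace_regular_def
    using polynomial_on_element_regular[OF _ _ poly_deg_le_real_polynomial_function[OF p(1)] p(2)]
      assms(3) by (simp add: convex_body_def)
qed

lemma neighbour_some:
  assumes "\<exists>K'. is_neighbour \<K> K F K'"
  shows "(SOME K'. is_neighbour \<K> K F K') \<in> \<K>" "F \<subseteq> (SOME K'. is_neighbour \<K> K F K')"
proof -
  have "is_neighbour \<K> K F (SOME K'. is_neighbour \<K> K F K')" by (rule someI_ex[OF assms])
  then show "(SOME K'. is_neighbour \<K> K F K') \<in> \<K>" "F \<subseteq> (SOME K'. is_neighbour \<K> K F K')"
    unfolding is_neighbour_def using facet_of_imp_subset by blast+
qed

lemma gradient_jump_sum:
  fixes f :: "'i \<Rightarrow> real^'n \<Rightarrow> real"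
  assumes bodies: "\<And>K. K \<in> \<K> \<Longrightarrow> convex_body K"
    and f: "\<And>K i. K \<in> \<K> \<Longrightarrow> i \<in> I \<Longrightarrow> laplace_regular K (f i)"
    and K: "K \<in> \<K>" "F facet_of K" and x: "x \<in> F"
  shows "gradient_jump \<K> K F (\<lambda>y. \<Sum>i\<in>I. c i * f i y) x = (\<Sum>i\<in>I. c i *\<^sub>R gradient_jump \<K> K F (f i) x)"
proof -
  have grad: "gradient_within L (\<lambda>y. \<Sum>i\<in>I. c i * f i y) x = (\<Sum>i\<in>I. c i *\<^sub>R gradient_within L (f i) x)"
    if "L \<in> \<K>" "x \<in> L" for L
    using bodies[OF that(1)] f[OF that(1)] that(2)
    by (intro gradient_within_sum) (auto simp: convex_body_def laplace_regular_def differentiable_on_def)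
  show ?thesis
  proof (cases "\<exists>K'. is_neighbour \<K> K F K'")
    case True
    have "x \<in> K" using K(2) x facet_of_imp_subset by blast
    then show ?thesis
      using True grad[OF K(1)] grad[OF neighbour_some(1)[OF True]] neighbour_some(2)[OF True] x
      by (simp add: gradient_jump_def subset_iff scaleR_right_diff_distrib sum_subtractf)
  next
    case False
    then show ?thesis by (simp add: gradient_jump_def)
  qed
qed

lemma gradient_jump_continuous_on:
  assumes f: "\<And>K. K \<in> \<K> \<Longrightarrow> laplace_regular K v" and K: "K \<in> \<K>" "F facet_of K"
  shows "continuous_on F (gradient_jump \<K> K F v)"
proof -
  have grad: "continuous_on F (gradient_within L v)" if "L \<in> \<K>" "F \<subseteq> L" for L
    using f[OF that(1)] that(2) differentiable_imp_continuous_on continuous_on_subset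
    unfolding laplace_regular_def by blast
  show ?thesis
  proof (cases "\<exists>K'. is_neighbour \<K> K F K'")
    case True
    then show ?thesis
      using grad[OF K(1) facet_of_imp_subset[OF K(2)]] grad[OF neighbour_some[OF True]]
      by (auto simp: gradient_jump_def[abs_def] intro!: continuous_on_diff)
  next
    case False
    then have "gradient_jump \<K> K F v = (\<lambda>_. 0)"
      unfolding gradient_jump_def by (intro ext if_not_P)
    then show ?thesis by simp
  qed
qed

section \<open>Comparison of the indicators for nearly orthogonal coefficients\<close>
lemma facet_integral_nonneg:
  "0 \<le> facet_integral F (\<lambda>x. (norm (g x))\<^sup>2)"
  unfolding facet_integral_def set_lebesgue_integral_def
  by (intro Bochner_Integration.integral_nonneg) simp

lemma jump_norm_power2:
  "(jump_norm \<K> K v)\<^sup>2 = (\<Sum>F | F facet_of K. facet_integral F (\<lambda>x. (norm (gradient_jump \<K> K F v x))\<^sup>2))"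
  by (simp add: jump_norm_def sum_nonneg facet_integral_nonneg)

lemma almost_orthogonal_facet:
  fixes m :: "'i \<Rightarrow> 'i \<Rightarrow> real" and f g :: "'i \<Rightarrow> real^'n \<Rightarrow> real^'n"
  assumes J: "finite J" "J \<noteq> {}"
    and gram: "\<And>j k. j \<in> J \<Longrightarrow> k \<in> J \<Longrightarrow>
        \<bar>(\<Sum>i\<in>J. m i j * m i k) - (if j = k then 1 else 0)\<bar> \<le> 1 / (2 * real (card J))"
    and F: "compact F" "F \<noteq> {}"
    and f: "\<And>i. i \<in> J \<Longrightarrow> continuous_on F (f i)"
    and g: "\<And>j x. j \<in> J \<Longrightarrow> x \<in> F \<Longrightarrow> g j x = (\<Sum>i\<in>J. m i j *\<^sub>R f i x)"
  shows "\<bar>(\<Sum>j\<in>J. facet_integral F (\<lambda>x. (norm (g j x))\<^sup>2)) - (\<Sum>i\<in>J. facet_integral F (\<lambda>x. (norm (f i x))\<^sup>2))\<bar>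
           \<le> (\<Sum>i\<in>J. facet_integral F (\<lambda>x. (norm (f i x))\<^sup>2)) / 2"
proof -
  let ?M = "hyperplane_measure (affine hull F)"
  \<comment> \<open>extend by zero off F, as the expansion of g is only known on F\<close>
  have cut: "facet_integral F (\<lambda>x. (norm (h x))\<^sup>2) = (LINT x|?M. (norm (indicator F x *\<^sub>R h x))\<^sup>2)"
    for h :: "real^'n \<Rightarrow> real^'n"
    unfolding facet_integral_def set_lebesgue_integral_def
    by (intro Bochner_Integration.integral_cong) (auto simp: indicator_def)
  have "integrable ?M (\<lambda>x. (indicator F x *\<^sub>R f i x) \<bullet> (indicator F x *\<^sub>R f k x))"
    if "i \<in> J" "k \<in> J" for i k
  proof -
    have "integrable ?M (\<lambda>x. indicator F x *\<^sub>R (f i x \<bullet> f k x))"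
      using facet_set_integrable[OF F continuous_on_inner[OF f[OF that(1)] f[OF that(2)]]]
      by (simp add: set_integrable_def)
    moreover have "(\<lambda>x. indicator F x *\<^sub>R (f i x \<bullet> f k x))
        = (\<lambda>x. (indicator F x *\<^sub>R f i x) \<bullet> (indicator F x *\<^sub>R f k x))"
      by (auto simp: indicator_def)
    ultimately show ?thesis by simp
  qed
  moreover have "indicator F x *\<^sub>R g j x = (\<Sum>i\<in>J. m i j *\<^sub>R indicator F x *\<^sub>R f i x)"
    if "j \<in> J" for j x
    using g[OF that] by (cases "x \<in> F") auto
  ultimately show ?thesis
    unfolding cut by (intro almost_orthogonal_integral[OF J gram])
qed

text \<open>
  Both terms of the indicator of \<Lambda> u j are built from the same linear combination, with
  coefficients m i j, of the element residuals and of the gradient jumps of the uh i. The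
  factor lamh i in the expansion of lam j * P (u j) is what makes the element residuals match.
  So the integrated estimate applies on the element and on each facet, and the weights,
  which are nonnegative, are common to both indicators.
\<close>
lemma indicator_comparison:
  fixes uh u :: "nat \<Rightarrow> real^'n \<Rightarrow> real" and P \<Lambda> :: "(real^'n \<Rightarrow> real) \<Rightarrow> real^'n \<Rightarrow> real"
  assumes J: "finite J" "J \<noteq> {}"
    and gram: "\<And>j k. j \<in> J \<Longrightarrow> k \<in> J \<Longrightarrow>
        \<bar>(\<Sum>i\<in>J. m i j * m i k) - (if j = k then 1 else 0)\<bar> \<le> 1 / (2 * real (card J))"
    and bodies: "\<And>K. K \<in> \<K> \<Longrightarrow> convex_body K"
    and regular: "\<And>K i. K \<in> \<K> \<Longrightarrow> i \<in> J \<Longrightarrow> laplace_regular K (uh i)"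
    and T: "T \<in> \<K>"
    and \<Lambda>: "\<And>j. j \<in> J \<Longrightarrow> \<Lambda> (u j) = (\<lambda>x. \<Sum>i\<in>J. m i j * uh i x)"
    and P: "\<And>j x. j \<in> J \<Longrightarrow> lam j * P (u j) x = (\<Sum>i\<in>J. m i j * (lamh i * uh i x))"
  shows "\<bar>(mu_indicator J \<K> lam u P \<Lambda> T)\<^sup>2 - (eta_indicator J \<K> lamh uh T)\<^sup>2\<bar>
           \<le> (eta_indicator J \<K> lamh uh T)\<^sup>2 / 2"
proof -
  define a where "a i = (L2_norm T (\<lambda>x. laplacian_within T (uh i) x + lamh i * uh i x))\<^sup>2" for i
  define a' where "a' j = (L2_norm T (\<lambda>x. lam j * P (u j) x + laplacian_within T (\<Lambda> (u j)) x))\<^sup>2" for j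
  define b where "b i = (jump_norm \<K> T (uh i))\<^sup>2" for i
  define b' where "b' j = (jump_norm \<K> T (\<Lambda> (u j)))\<^sup>2" for j
  define h where "h = diameter T"
  have body: "convex T" "compact T" "interior T \<noteq> {}" using bodies[OF T] by (auto simp: convex_body_def)
  have h: "0 \<le> h"
    using body by (simp add: h_def diameter_ge_0 compact_imp_bounded)
  have eta: "(eta_indicator J \<K> lamh uh T)\<^sup>2 = h\<^sup>2 * sum a J + h * sum b J"
    using h by (simp add: eta_indicator_def a_def b_def h_def sum_nonneg sum.distrib sum_distrib_left)
  have mu: "(mu_indicator J \<K> lam u P \<Lambda> T)\<^sup>2 = h\<^sup>2 * sum a' J + h * sum b' J"
    using h by (simp add: mu_indicator_def a'_def b'_def h_def sum_nonneg sum.distrib sum_distrib_left)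
  have "\<bar>sum a' J - sum a J\<bar> \<le> sum a J / 2"
    unfolding a_def a'_def L2_norm_power2
  proof (rule almost_orthogonal_integral[OF J gram])
    fix i k assume "i \<in> J" "k \<in> J"
    have "continuous_on T (\<lambda>x. laplacian_within T (uh j) x + lamh j * uh j x)" if "j \<in> J" for j
      using regular[OF T that] differentiable_imp_continuous_on unfolding laplace_regular_def
      by (intro continuous_intros) auto
    then have "continuous_on T (\<lambda>x. (laplacian_within T (uh i) x + lamh i * uh i x)
          \<bullet> (laplacian_within T (uh k) x + lamh k * uh k x))"
      using \<open>i \<in> J\<close> \<open>k \<in> J\<close> by (intro continuous_on_inner)
    then show "integrable (lebesgue_on T) (\<lambda>x. (laplacian_within T (uh i) x + lamh i * uh i x)
          \<bullet> (laplacian_within T (uh k) x + lamh k * uh k x))"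
      by (rule continuous_compact_integrable[OF body(2)])
  next
    fix j x assume j: "j \<in> J" and "x \<in> space (lebesgue_on T)"
    then have "x \<in> T" by simp
    then have "laplacian_within T (\<Lambda> (u j)) x = (\<Sum>i\<in>J. m i j * laplacian_within T (uh i) x)"
      unfolding \<Lambda>[OF j] using regular[OF T] body
      by (intro laplacian_within_sum) (auto simp: laplace_regular_def)
    then show "lam j * P (u j) x + laplacian_within T (\<Lambda> (u j)) x
        = (\<Sum>i\<in>J. m i j *\<^sub>R (laplacian_within T (uh i) x + lamh i * uh i x))"
      by (simp add: P[OF j] sum.distrib[symmetric] distrib_left add.commute)
  qed
  moreover have "\<bar>sum b' J - sum b J\<bar> \<le> sum b J / 2"
  proof -
    define \<F> where "\<F> = {F. F facet_of T}"
    define c where "c i F = facet_integral F (\<lambda>x. (norm (gradient_jump \<K> T F (uh i) x))\<^sup>2)" for i F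
    define c' where "c' j F = facet_integral F (\<lambda>x. (norm (gradient_jump \<K> T F (\<Lambda> (u j)) x))\<^sup>2)" for j F
    have facet: "\<bar>(\<Sum>j\<in>J. c' j F) - (\<Sum>i\<in>J. c i F)\<bar> \<le> (\<Sum>i\<in>J. c i F) / 2" if "F \<in> \<F>" for F
      unfolding c_def c'_def
    proof (rule almost_orthogonal_facet[OF J gram])
      have F: "F facet_of T" using that by (simp add: \<F>_def)
      show "compact F"
        using F body face_of_imp_compact facet_of_imp_face_of by blast
      show "F \<noteq> {}" using F by (simp add: facet_of_def)
      show "continuous_on F (gradient_jump \<K> T F (uh i))" if "i \<in> J" for i
        using regular that by (intro gradient_jump_continuous_on[OF _ T F]) auto
      show "gradient_jump \<K> T F (\<Lambda> (u j)) x = (\<Sum>i\<in>J. m i j *\<^sub>R gradient_jump \<K> T F (uh i) x)"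
        if "j \<in> J" "x \<in> F" for j x
        unfolding \<Lambda>[OF that(1)] using bodies regular T F that(2) by (rule gradient_jump_sum)
    qed
    have "b = (\<lambda>i. \<Sum>F\<in>\<F>. c i F)" "b' = (\<lambda>j. \<Sum>F\<in>\<F>. c' j F)"
      by (simp_all add: fun_eq_iff b_def b'_def jump_norm_power2 c_def c'_def \<F>_def)
    then have b: "sum b J = (\<Sum>F\<in>\<F>. \<Sum>i\<in>J. c i F)" "sum b' J = (\<Sum>F\<in>\<F>. \<Sum>j\<in>J. c' j F)"
      by (simp_all only: sum.swap[of _ \<F> J])
    have "\<bar>sum b' J - sum b J\<bar> \<le> (\<Sum>F\<in>\<F>. \<bar>(\<Sum>j\<in>J. c' j F) - (\<Sum>i\<in>J. c i F)\<bar>)"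
      unfolding b sum_subtractf[symmetric] by (rule sum_abs)
    also have "\<dots> \<le> (\<Sum>F\<in>\<F>. (\<Sum>i\<in>J. c i F) / 2)" by (intro sum_mono facet)
    also have "\<dots> = sum b J / 2" by (simp add: b sum_divide_distrib)
    finally show ?thesis .
  qed
  ultimately have "h\<^sup>2 * \<bar>sum a' J - sum a J\<bar> + h * \<bar>sum b' J - sum b J\<bar> \<le> h\<^sup>2 * (sum a J / 2) + h * (sum b J / 2)"
    using h by (intro add_mono mult_left_mono) auto
  moreover have "\<bar>(h\<^sup>2 * sum a' J + h * sum b' J) - (h\<^sup>2 * sum a J + h * sum b J)\<bar>
      \<le> \<bar>h\<^sup>2 * (sum a' J - sum a J)\<bar> + \<bar>h * (sum b' J - sum b J)\<bar>"
    by (simp add: right_diff_distrib)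
  ultimately show ?thesis using h by (simp add: eta mu abs_mult)
qed

section \<open>The cluster of discrete eigenfunctions\<close>
text \<open>
  Both sides equal the Dirichlet form of w and wh: the left one by the continuous eigenvalue
  equation tested with wh, the right one by the discrete equation tested with G w and the
  defining property of the Ritz projection.
\<close>
lemma cluster_coefficient_relation:
  fixes uh u :: "nat \<Rightarrow> real^'n \<Rightarrow> real"
  assumes V: "V \<subseteq> H10 D"
    and ev: "w \<in> H10 D" "\<And>v. v \<in> H10 D \<Longrightarrow> dirichlet_form D w v = \<mu> * L2_inner D w v"
    and evh: "wh \<in> V" "\<And>v. v \<in> V \<Longrightarrow> dirichlet_form D wh v = \<nu> * L2_inner D wh v"
    and W: "wh \<in> W" and P: "is_L2_projection D W P" and G: "is_Ritz_projection D V G"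
  shows "\<mu> * L2_inner D (P w) wh = \<nu> * L2_inner D (P (G w)) wh"
proof -
  have sub: "H10 D \<subseteq> L2 D" by (auto simp: H10_def H1_def)
  have Gw: "G w \<in> V" "dirichlet_form D (G w) wh = dirichlet_form D w wh"
    using G ev(1) evh(1) by (auto simp: is_Ritz_projection_def)
  have proj: "L2_inner D (P f) wh = L2_inner D f wh" if "f \<in> H10 D" for f
    using P W sub that by (auto simp: is_L2_projection_def)
  have "\<mu> * L2_inner D (P w) wh = dirichlet_form D w wh"
    using ev evh(1) V proj by auto
  also have "\<dots> = dirichlet_form D wh (G w)"
    using Gw(2) by (simp add: dirichlet_form_def inner_commute)
  also have "\<dots> = \<nu> * L2_inner D (P (G w)) wh"
    using evh(2)[OF Gw(1)] proj Gw(1) V by (auto simp: L2_inner_commute[of D wh])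
  finally show ?thesis .
qed

theorem lemma3p1:
  fixes \<Omega> :: "(real^'n::finite) set"
    and lam :: "nat \<Rightarrow> real" and u :: "nat \<Rightarrow> real^'n \<Rightarrow> real"
    and \<T> :: "nat \<Rightarrow> 'n tagged_simplex set"
    and r n N l :: nat
    and V W :: "nat \<Rightarrow> (real^'n \<Rightarrow> real) set"
    and lamh :: "nat \<Rightarrow> nat \<Rightarrow> real" and uh :: "nat \<Rightarrow> nat \<Rightarrow> real^'n \<Rightarrow> real"
    and P G \<Lambda> :: "nat \<Rightarrow> (real^'n \<Rightarrow> real) \<Rightarrow> real^'n \<Rightarrow> real"
    and J :: "nat set"
  assumes "CARD('n) \<in> {2, 3}"
    and "polyhedral_domain \<Omega>"
    and "dirichlet_eigensystem \<Omega> lam u"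
    and "\<And>k. conforming_mesh \<Omega> (\<T> k)"
    and "\<And>k. nvb_refinement (\<T> k) (\<T> (Suc k))"
    and "r \<ge> 1"
    and V_def: "\<And>k. V k = fe_space \<Omega> (elements (\<T> k)) r"
    and "\<And>k. discrete_eigensystem \<Omega> (V k) (lamh k) (uh k)"
    and "N \<ge> 1"
    and J_def: "J = {n + 1..n + N}"
    and "n + N \<le> fun_dim (V 0)"
    and "lam n < lam (n + 1)" and "lam (n + N) < lam (n + N + 1)"
    and "\<And>k. lamh k n < lam (n + 1)" and "\<And>k. lamh k (n + N) < lam (n + N + 1)"
    and W_def: "\<And>k. W k = fun_span (uh k ` J)"
    and "\<And>k. is_L2_projection \<Omega> (W k) (P k)"
    and "\<And>k. is_Ritz_projection \<Omega> (V k) (G k)"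
    and Lambda_def: "\<And>k. \<Lambda> k = P k \<circ> G k"
    and "Max ((\<lambda>j. L2_norm \<Omega> (\<lambda>x. u j x - \<Lambda> l (u j) x)) ` J) \<le> sqrt (1 + 1 / (2 * real N)) - 1"
  shows "\<forall>T \<in> elements (\<T> l).
      (mu_indicator J (elements (\<T> l)) lam u (P l) (\<Lambda> l) T)^2
        \<le> 3/2 * (eta_indicator J (elements (\<T> l)) (lamh l) (uh l) T)^2
    \<and> 3/2 * (eta_indicator J (elements (\<T> l)) (lamh l) (uh l) T)^2
        \<le> 3 * (mu_indicator J (elements (\<T> l)) lam u (P l) (\<Lambda> l) T)^2"
proof
  fix T assume T: "T \<in> elements (\<T> l)"
  note eigensystem = assms(3) and mesh = assms(4) and nvb = assms(5) and V = V_def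
    and discrete = assms(8) and small = assms(20)
    and P = assms(17)[of l] and G = assms(18)[of l] and \<Lambda> = Lambda_def[of l]

  have J: "finite J" "J \<noteq> {}" "card J = N" "\<And>j. j \<in> J \<Longrightarrow> 1 \<le> j"
    using \<open>N \<ge> 1\<close> by (auto simp: J_def)
  \<comment> \<open>The finite element spaces are nested, so that the cluster indices are valid on every level.\<close>
  have "V k \<subseteq> V (Suc k)" for k
    unfolding V
  proof (intro fe_space_mono nvb_refinement_nested)
    show "nvb_refinement (\<T> k) (\<T> (Suc k))" by (rule nvb)
    show "wf_tagged_simplex t" if "t \<in> \<T> k" for t
      using mesh[of k] that unfolding conforming_mesh_def by blast
  qed
  then have "V 0 \<subseteq> V l" by (rule lift_Suc_mono_le[of V]) simp
  moreover have span: "fun_span (uh l ` {1..fun_dim (V l)}) = V l"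
    using discrete[of l] by (simp only: discrete_eigensystem_def)
  ultimately have "fun_dim (V 0) \<le> fun_dim (V l)" by (rule fun_dim_mono)
  then have J_le: "J \<subseteq> {1..fun_dim (V l)}" using \<open>n + N \<le> fun_dim (V 0)\<close> by (auto simp: J_def)

  have V_H10: "V l \<subseteq> H10 \<Omega>" by (auto simp: V fe_space_def)
  have H10_L2: "H10 \<Omega> \<subseteq> L2 \<Omega>" by (auto simp: H10_def H1_def)
  have u: "u j \<in> H10 \<Omega>" "\<And>v. v \<in> H10 \<Omega> \<Longrightarrow> dirichlet_form \<Omega> (u j) v = lam j * L2_inner \<Omega> (u j) v"
    if "j \<in> J" for j
    using eigensystem J(4)[OF that] by (auto simp: dirichlet_eigensystem_def)
  have u_on: "L2_orthonormal_on \<Omega> J u"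
    using eigensystem J(4) by (auto simp: dirichlet_eigensystem_def L2_orthonormal_on_def)
  have uh: "uh l i \<in> V l" "\<And>v. v \<in> V l \<Longrightarrow> dirichlet_form \<Omega> (uh l i) v = lamh l i * L2_inner \<Omega> (uh l i) v"
    if "i \<in> J" for i
    using discrete[of l] subsetD[OF J_le that] unfolding discrete_eigensystem_def by blast+
  have uh_on: "L2_orthonormal_on \<Omega> J (uh l)"
    using discrete[of l] J_le unfolding discrete_eigensystem_def L2_orthonormal_on_def by blast
  have uh_L2: "uh l i \<in> L2 \<Omega>" if "i \<in> J" for i
    using uh(1)[OF that] V_H10 H10_L2 by blast
  have uh_W: "uh l i \<in> W l" if "i \<in> J" for i
    unfolding W_def using fun_span_superset that by blast
  have P_W: "P l f \<in> W l" if "f \<in> H10 \<Omega>" for f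
    using P that H10_L2 by (auto simp: is_L2_projection_def)
  have G_V: "G l (u j) \<in> V l" if "j \<in> J" for j
    using G u(1)[OF that] by (auto simp: is_Ritz_projection_def)
  have \<Lambda>_W: "\<Lambda> l (u j) \<in> W l" if "j \<in> J" for j
    using P_W[of "G l (u j)"] G_V[OF that] V_H10 by (auto simp: \<Lambda>)

  \<comment> \<open>the matrix M of \<Lambda> applied to the u j, expanded in the discrete eigenbasis of the cluster\<close>
  define m where "m i j = L2_inner \<Omega> (\<Lambda> l (u j)) (uh l i)" for i j
  have expand: "w = (\<lambda>x. \<Sum>i\<in>J. L2_inner \<Omega> w (uh l i) * uh l i x)" if "w \<in> W l" for w
    using that orthonormal_expansion[OF uh_on uh_L2 J(1)] unfolding W_def by blast
  have \<Lambda>_expand: "\<Lambda> l (u j) = (\<lambda>x. \<Sum>i\<in>J. m i j * uh l i x)" if "j \<in> J" for j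
    unfolding m_def by (rule expand[OF \<Lambda>_W[OF that]])
  have P_expand: "lam j * P l (u j) x = (\<Sum>i\<in>J. m i j * (lamh l i * uh l i x))" if "j \<in> J" for j x
  proof -
    let ?c = "\<lambda>i. L2_inner \<Omega> (P l (u j)) (uh l i)"
    have coeff: "lam j * ?c i = lamh l i * m i j" if i: "i \<in> J" for i
      using cluster_coefficient_relation[OF V_H10 u[OF \<open>j \<in> J\<close>] uh[OF i] uh_W[OF i] P G]
      by (simp add: m_def \<Lambda>)
    have "lam j * P l (u j) x = lam j * (\<Sum>i\<in>J. ?c i * uh l i x)"
      by (rule arg_cong[OF fun_cong[OF expand[OF P_W[OF u(1)[OF that]]]]])
    also have "\<dots> = (\<Sum>i\<in>J. (lam j * ?c i) * uh l i x)"
      by (simp add: sum_distrib_left mult.assoc)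
    also have "\<dots> = (\<Sum>i\<in>J. m i j * (lamh l i * uh l i x))"
      by (intro sum.cong refl) (simp only: coeff ac_simps)
    finally show ?thesis .
  qed
  have \<Lambda>_L2: "\<Lambda> l (u j) \<in> L2 \<Omega>" if "j \<in> J" for j
  proof -
    have "W l \<subseteq> V l"
      using fun_span_mono[OF image_mono[OF J_le, of "uh l"]] by (simp only: W_def span)
    then show ?thesis using \<Lambda>_W[OF that] V_H10 H10_L2 by blast
  qed
  have gram: "\<bar>(\<Sum>i\<in>J. m i j * m i k) - (if j = k then 1 else 0)\<bar> \<le> 1 / (2 * real (card J))"
    if jk: "j \<in> J" "k \<in> J" for j k
  proof -
    have "L2_norm \<Omega> (\<lambda>x. u j x - \<Lambda> l (u j) x) \<le> sqrt (1 + 1 / (2 * real N)) - 1" if "j \<in> J" for j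
      using small J(1) that by (intro order_trans[OF Max_ge small]) auto
    then have "\<bar>L2_inner \<Omega> (\<Lambda> l (u j)) (\<Lambda> l (u k)) - (if j = k then 1 else 0)\<bar>
        \<le> (1 + (sqrt (1 + 1 / (2 * real N)) - 1))\<^sup>2 - 1"
      using u(1) H10_L2 \<Lambda>_L2 by (intro gram_of_perturbed_orthonormal[OF u_on jk]) auto
    moreover have "(1 + (sqrt (1 + 1 / (2 * real N)) - 1))\<^sup>2 - 1 = 1 / (2 * real (card J))"
      by (simp add: J(3))
    \<comment> \<open>Parseval: the entries of M^T M are the inner products of the projected eigenfunctions.\<close>
    moreover have "L2_inner \<Omega> (\<Lambda> l (u j)) (\<Lambda> l (u k)) = (\<Sum>i\<in>J. m i j * m i k)"
    proof -
      have "L2_inner \<Omega> (\<lambda>x. \<Sum>i\<in>J. m i j * uh l i x) (\<Lambda> l (u k))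
          = (\<Sum>i\<in>J. m i j * L2_inner \<Omega> (uh l i) (\<Lambda> l (u k)))"
        using uh_L2 \<Lambda>_L2[OF jk(2)] by (rule L2_inner_sum_left)
      also have "\<dots> = (\<Sum>i\<in>J. m i j * m i k)"
        by (simp add: m_def[of _ k] L2_inner_commute[of \<Omega> "uh l _"])
      finally show ?thesis using \<Lambda>_expand[OF jk(1)] by simp
    qed
    ultimately show ?thesis by simp
  qed

  have bodies: "convex_body K" if "K \<in> elements (\<T> l)" for K
    using that mesh[of l] hull_of_convex_body by (auto simp: elements_def conforming_mesh_def)
  have regular: "laplace_regular K (uh l i)" if "K \<in> elements (\<T> l)" "i \<in> J" for K i
    using uh(1)[OF that(2)] that(1) bodies[OF that(1)] unfolding V by (rule fe_space_laplace_regular)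
  have "\<bar>(mu_indicator J (elements (\<T> l)) lam u (P l) (\<Lambda> l) T)\<^sup>2
        - (eta_indicator J (elements (\<T> l)) (lamh l) (uh l) T)\<^sup>2\<bar>
      \<le> (eta_indicator J (elements (\<T> l)) (lamh l) (uh l) T)\<^sup>2 / 2"
    using J(1,2) gram bodies regular T \<Lambda>_expand P_expand by (rule indicator_comparison)
  then show "(mu_indicator J (elements (\<T> l)) lam u (P l) (\<Lambda> l) T)^2
        \<le> 3/2 * (eta_indicator J (elements (\<T> l)) (lamh l) (uh l) T)^2
    \<and> 3/2 * (eta_indicator J (elements (\<T> l)) (lamh l) (uh l) T)^2
        \<le> 3 * (mu_indicator J (elements (\<T> l)) lam u (P l) (\<Lambda> l) T)^2"
    by linarith
qed

end
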